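(* Assume that $\varphi$ satisfies the Hölderian error bound with parameter $\tau>0$ and that $\operatorname{int}(\operatorname{dom}\omega)\cap X'\neq\emptyset$. Let $\{\mathbf{x}^{k}\}$ be a sequence generated by the algorithm FBi-PG (defined in the context, with $t_k=(k+a)/a$ for $k\ge 0$) with $1<\gamma<2$ and an integer $a>2$. Then the sequence $\{\mathbf{x}^{k}\}$ converges to some $\mathbf{x}'\in X'$.
   Context: Bi-level problem: the inner problem is $\min_{\mathbf{x}\in\mathbb{R}^n}\{\varphi(\mathbf{x}):=f(\mathbf{x})+g(\mathbf{x})\}$ with solution set $X^{\ast}$; the outer problem is $\min_{\mathbf{x}\in X^{\ast}}\{\omega(\mathbf{x}):=\sigma(\mathbf{x})+\psi(\mathbf{x})\}$, and $X'\subset X^{\ast}$ is the set of its optimal solutions (minimizers of $\omega$ over $X^\ast$, at which $\omega$ is finite). Standing assumptions: (i) $f,\sigma:\mathbb{R}^n\to\mathbb{R}$ are convex and continuously differentiable with Lipschitz continuous gradients with constants $\beta_f,\beta_\sigma$, and $\beta:=\beta_f+\beta_\sigma>0$; (ii) $g,\psi:\mathbb{R}^n\to(-\infty,\infty]$ are proper, lower semicontinuous and convex; (iii) $X^{\ast}\ne\emptyset$; (iv) $\omega^{\ast}:=\inf_{\mathbf{x}\in\mathbb{R}^n}\omega(\mathbf{x})>-\infty$. Norms are Euclidean. Hölderian error bound: a proper, lower semicontinuous, convex $h:\mathbb{R}^n\to(-\infty,+\infty]$ satisfies it with parameter $\tau>0$ if $\tau\cdot\operatorname{dist}(\mathbf{x},\operatorname{arg\,min}h)^2\le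 h(\mathbf{x})-\min_{\mathbf{z}\in\mathbb{R}^n}h(\mathbf{z})$ for all $\mathbf{x}\in\mathbb{R}^n$. Algorithm FBi-PG: input $\gamma>0$ and an integer $a\ge 2$. Set $\alpha_{-1}=t_{-1}=0$, $\mathbf{x}^{0}=\mathbf{x}^{-1}\in\mathbb{R}^n$ arbitrary, and for $k\ge0$ let $\alpha_k=(k+a)^{-\gamma}$, $t_k=(k+a)/a$, $f_k=f+\alpha_k\sigma$, $g_k=g+\alpha_k\psi$. For $k=0,1,2,\ldots$: $$\mathbf{y}^{k}=\mathbf{x}^{k}+t_k^{-1}(t_{k-1}-1)(\mathbf{x}^{k}-\mathbf{x}^{k-1}),\qquad \mathbf{x}^{k+1}=\operatorname*{arg\,min}_{\mathbf{x}\in\mathbb{R}^n}\Bigl\{g_k(\mathbf{x})+\mathbf{x}^{T}\nabla f_k(\mathbf{y}^{k})+\tfrac{\beta}{2}\|\mathbf{x}-\mathbf{y}^{k}\|^{2}\Bigr\}.$$ *)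

theory Defs
  imports "HOL-Analysis.Analysis"
begin

definition grad :: "('a::real_inner \<Rightarrow> real) \<Rightarrow> 'a \<Rightarrow> 'a" where
  "grad h x = (THE D. GDERIV h x :> D)"

definition continuously_differentiable :: "('a::real_inner \<Rightarrow> real) \<Rightarrow> bool" where
  "continuously_differentiable h \<longleftrightarrow>
     (\<forall>x. \<exists>D. GDERIV h x :> D) \<and> continuous_on UNIV (grad h)"

definition proper :: "('a \<Rightarrow> ereal) \<Rightarrow> bool" where
  "proper h \<longleftrightarrow> (\<forall>x. h x \<noteq> -\<infinity>) \<and> (\<exists>x. h x \<noteq> \<infinity>)"

definition lower_semicontinuous :: "('a::topological_space \<Rightarrow> ereal) \<Rightarrow> bool" where
  "lower_semicontinuous h \<longleftrightarrow> (\<forall>x. h x \<le> Liminf (at x) h)"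

text \<open>Only applied to functions that never take the value \<open>-\<infinity>\<close>, so no sum
  \<open>\<infinity> + (-\<infinity>)\<close> occurs; products obey \<open>0 * \<infinity> = 0\<close>, hence the
  cases \<open>u = 0\<close> and \<open>v = 0\<close> hold trivially.\<close>

definition convex_ereal :: "('a::real_vector \<Rightarrow> ereal) \<Rightarrow> bool" where
  "convex_ereal h \<longleftrightarrow>
     (\<forall>x y. \<forall>u\<ge>0. \<forall>v\<ge>0. u + v = 1 \<longrightarrow>
        h (u *\<^sub>R x + v *\<^sub>R y) \<le> ereal u * h x + ereal v * h y)"

definition effective_domain :: "('a \<Rightarrow> ereal) \<Rightarrow> 'a set" where
  "effective_domain h = {x. h x < \<infinity>}"

definition argmin_set :: "('a \<Rightarrow> ereal) \<Rightarrow> 'a set" where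
  "argmin_set h = {x. is_arg_min h (\<lambda>_. True) x}"

text \<open>The nonemptiness conjunct records that \<open>min h\<close> is attained (its value is then the
  infimum); it also rules out the library convention \<open>infdist x {} = 0\<close>.\<close>

definition holder_error_bound :: "('a::metric_space \<Rightarrow> ereal) \<Rightarrow> real \<Rightarrow> bool" where
  "holder_error_bound h \<tau> \<longleftrightarrow>
     \<tau> > 0 \<and> argmin_set h \<noteq> {} \<and>
     (\<forall>x. ereal (\<tau> * (infdist x (argmin_set h))\<^sup>2) \<le> h x - (INF z. h z))"

definition composite :: "('a \<Rightarrow> real) \<Rightarrow> ('a \<Rightarrow> ereal) \<Rightarrow> 'a \<Rightarrow> ereal" where
  "composite s r x = ereal (s x) + r x"

definition bilevel_solutions ::
    "('a \<Rightarrow> ereal) \<Rightarrow> ('a \<Rightarrow> ereal) \<Rightarrow> 'a set" where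
  "bilevel_solutions \<phi> \<omega> =
     {x. is_arg_min \<omega> (\<lambda>z. z \<in> argmin_set \<phi>) x \<and> \<bar>\<omega> x\<bar> \<noteq> \<infinity>}"

text \<open>Sequences are indexed by integers because the method refers to the index \<open>-1\<close>;
  values at indices below \<open>-1\<close> are never used.\<close>

definition fbipg_alpha :: "real \<Rightarrow> int \<Rightarrow> int \<Rightarrow> real" where
  "fbipg_alpha \<gamma> a k = (if k < 0 then 0 else real_of_int (k + a) powr (- \<gamma>))"

definition fbipg_t :: "int \<Rightarrow> int \<Rightarrow> real" where
  "fbipg_t a k = (if k < 0 then 0 else real_of_int (k + a) / real_of_int a)"

definition fbipg_y :: "int \<Rightarrow> (int \<Rightarrow> 'a::real_vector) \<Rightarrow> int \<Rightarrow> 'a" where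
  "fbipg_y a x k =
     x k + (inverse (fbipg_t a k) * (fbipg_t a (k - 1) - 1)) *\<^sub>R (x k - x (k - 1))"

definition fbipg_smooth ::
    "('a \<Rightarrow> real) \<Rightarrow> ('a \<Rightarrow> real) \<Rightarrow> real \<Rightarrow> int \<Rightarrow> int \<Rightarrow> 'a \<Rightarrow> real" where
  "fbipg_smooth f \<sigma> \<gamma> a k z = f z + fbipg_alpha \<gamma> a k * \<sigma> z"

definition fbipg_nonsmooth ::
    "('a \<Rightarrow> ereal) \<Rightarrow> ('a \<Rightarrow> ereal) \<Rightarrow> real \<Rightarrow> int \<Rightarrow> int \<Rightarrow> 'a \<Rightarrow> ereal" where
  "fbipg_nonsmooth g \<psi> \<gamma> a k z = g z + ereal (fbipg_alpha \<gamma> a k) * \<psi> z"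

text \<open>The subproblem objective is strongly convex for \<open>\<beta> > 0\<close>, so it has at most one
  minimiser (when it is proper) and membership in the set of minimisers determines the iterate.\<close>

definition fbipg_sequence ::
    "('a::real_inner \<Rightarrow> real) \<Rightarrow> ('a \<Rightarrow> real) \<Rightarrow> ('a \<Rightarrow> ereal) \<Rightarrow> ('a \<Rightarrow> ereal) \<Rightarrow>
     real \<Rightarrow> real \<Rightarrow> int \<Rightarrow> (int \<Rightarrow> 'a) \<Rightarrow> bool" where
  "fbipg_sequence f \<sigma> g \<psi> \<beta> \<gamma> a x \<longleftrightarrow>
     x (-1) = x 0 \<and>
     (\<forall>k\<ge>0. x (k + 1) \<in> argmin_set (\<lambda>z.
        fbipg_nonsmooth g \<psi> \<gamma> a k z +
        ereal (z \<bullet> grad (fbipg_smooth f \<sigma> \<gamma> a k) (fbipg_y a x k) +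
               \<beta> / 2 * (norm (z - fbipg_y a x k))\<^sup>2)))"

end

theory Submission
  imports Defs
begin

text \<open>The energy that drives the proof compares the regularised objective
  \<open>\<phi> + \<alpha>\<^sub>k \<omega>\<close> with its value at a bilevel solution. The difficulty is that
  \<open>\<omega>\<close> may be smaller at an iterate than its optimal value \<open>\<omega>'\<close> over the inner solution
  set \<open>X\<close>, so this difference has no sign. Two facts control the deficit. Since some bilevel
  solution lies in the interior of the domain of \<open>\<omega>\<close>, the distance to \<open>X\<close> is an exact penalty:
  \<open>\<omega> z \<ge> \<omega>' - L * dist z X\<close> for every \<open>z\<close> (\<open>slater_exact_penalty\<close>).
  And the error bound gives \<open>\<phi> z - \<phi>' \<ge> \<tau> * (dist z X)\<^sup>2\<close>. By Young's inequality
  \<open>E\<^sub>k z = (\<phi> z - \<phi>') + \<alpha>\<^sub>k (\<omega> z - \<omega>') + (L\<^sup>2 / 2\<tau>) \<alpha>\<^sub>k\<^sup>2\<close> is then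
  nonnegative, and even bounds a multiple of \<open>(dist z X)\<^sup>2\<close>.

  The usual analysis of accelerated proximal gradient steps applies to \<open>E\<^sub>k\<close> up to errors.
  The added constant costs \<open>t\<^sub>k \<alpha>\<^sub>k\<^sup>2\<close>, and so does the change of \<open>\<alpha>\<close> from one step
  to the next, once the part proportional to \<open>E\<^sub>k\<close> has been absorbed in the slack
  \<open>t\<^sub>k\<^sub>-\<^sub>1\<^sup>2 - t\<^sub>k\<^sup>2 + t\<^sub>k\<close>, which is of order \<open>t\<^sub>k\<close> because \<open>a > 2\<close>. These errors are
  summable exactly when \<open>\<gamma> > 1\<close>. Following Chambolle and Dossal, a first Lyapunov
  function gives \<open>\<Sum> t\<^sub>k E\<^sub>k < \<infinity>\<close>; a second one, in which the comparison point is the previous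
  iterate, gives \<open>t\<^sub>k\<^sup>2 E\<^sub>k \<rightarrow> 0\<close> and \<open>t\<^sub>k \<parallel>x\<^sub>k - x\<^sub>k\<^sub>-\<^sub>1\<parallel> \<rightarrow> 0\<close>
  (\<open>energy_decay\<close>). Together they make the distance from \<open>x\<^sub>k\<close> to each bilevel solution converge.

  Because \<open>\<gamma> < 2\<close>, the products \<open>t\<^sub>k\<^sup>2 \<alpha>\<^sub>k\<close> are bounded below, so \<open>t\<^sub>k\<^sup>2 E\<^sub>k \<rightarrow> 0\<close> also
  forces \<open>limsup \<omega> x\<^sub>k \<le> \<omega>'\<close>, while \<open>\<phi> x\<^sub>k \<rightarrow> \<phi>'\<close>. By lower semicontinuity every cluster point
  is a bilevel solution, and Opial's argument turns this into convergence of the whole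
  sequence (\<open>regularized_fista_converges\<close>).\<close>

section \<open>Almost decreasing sequences\<close>

text \<open>Subtracting the partial sums of the errors from \<open>v\<close> leaves a decreasing sequence that
  is bounded below; its total decrease also bounds the sum of \<open>p\<close>.\<close>
lemma quasi_fejer_convergence:
  fixes v p b :: "nat \<Rightarrow> real"
  assumes v: "\<And>n. 0 \<le> v n" and p: "\<And>n. 0 \<le> p n" and b: "summable b"
    and step: "\<And>n. v (Suc n) \<le> v n - p n + b n"
  shows "convergent v" and "summable p"
proof -
  define u where "u n = v n - (\<Sum>i<n. b i)" for n
  have u_step: "u (Suc n) \<le> u n - p n" for n
    using step[of n] by (simp add: u_def)
  have "decseq u"
    using u_step p by (intro decseq_SucI) (smt (verit))
  have "convergent (\<lambda>n. \<Sum>i<n. b i)"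
    using b by (simp add: summable_iff_convergent)
  then have "Bseq (\<lambda>n. \<Sum>i<n. b i)"
    by (rule convergent_imp_Bseq)
  then obtain B where B: "\<And>n. \<bar>\<Sum>i<n. b i\<bar> \<le> B"
    by (auto simp: Bseq_def)
  have u_lower: "- B \<le> u n" for n
    using v[of n] B[of n] by (simp add: u_def)
  obtain L where "u \<longlonglongrightarrow> L"
    using decseq_convergent[OF \<open>decseq u\<close>] u_lower by blast
  then have "convergent u" by (rule convergentI)
  then have "convergent (\<lambda>n. u n + (\<Sum>i<n. b i))"
    using \<open>convergent (\<lambda>n. \<Sum>i<n. b i)\<close> by (rule convergent_add)
  then show "convergent v" by (simp add: u_def)
  have sum_p: "(\<Sum>i<n. p i) \<le> u 0 - u n" for n
  proof (induction n)
    case (Suc n)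
    then show ?case using u_step[of n] by simp
  qed simp
  show "summable p"
  proof (rule summableI_nonneg_bounded)
    show "(\<Sum>i<n. p i) \<le> u 0 + B" for n
      using sum_p[of n] u_lower[of n] by linarith
  qed (rule p)
qed

section \<open>Smooth functions\<close>

lemma GDERIV_unique:
  assumes "GDERIV h x :> D" "GDERIV h x :> D'"
  shows "D = D'"
proof -
  have "(\<lambda>v. v \<bullet> D) = (\<lambda>v. v \<bullet> D')"
    using assms has_derivative_unique unfolding gderiv_def by blast
  then have "(D - D') \<bullet> D = (D - D') \<bullet> D'" by metis
  then have "(D - D') \<bullet> (D - D') = 0"
    by (subst inner_diff_right) simp
  then show ?thesis by simp
qed

lemma grad_eqI: "GDERIV h x :> D \<Longrightarrow> grad h x = D"
  unfolding grad_def by (rule the1_equality) (auto intro: GDERIV_unique)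

lemma GDERIV_grad: "continuously_differentiable h \<Longrightarrow> GDERIV h x :> grad h x"
  by (auto simp: continuously_differentiable_def dest: grad_eqI)

lemma GDERIV_along_line:
  assumes "GDERIV h (y + s *\<^sub>R v) :> D"
  shows "((\<lambda>s. h (y + s *\<^sub>R v)) has_real_derivative v \<bullet> D) (at s)"
proof -
  have "((\<lambda>s. y + s *\<^sub>R v) has_derivative (\<lambda>h. h *\<^sub>R v)) (at s)"
    by (auto intro!: derivative_eq_intros)
  from has_derivative_compose[OF this, of h "\<lambda>v. v \<bullet> D"] assms
  show ?thesis
    unfolding gderiv_def has_field_derivative_def
    by (simp add: mult_commute_abs)
qed

text \<open>The Lipschitz bound makes the difference between \<open>h\<close> and the quadratic model
  nonincreasing along the segment from \<open>y\<close> to \<open>z\<close>. Comparing its derivative, rather than using the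
  mean value theorem, gives the factor \<open>1/2\<close>, which the constant \<open>\<beta>\<close> of the algorithm requires.\<close>
lemma descent_lemma:
  fixes h :: "'a::real_inner \<Rightarrow> real"
  assumes "continuously_differentiable h" and lip: "B-lipschitz_on UNIV (grad h)"
  shows "h z \<le> h y + (z - y) \<bullet> grad h y + B / 2 * (norm (z - y))\<^sup>2"
proof -
  define v where "v = z - y"
  define q where "q s = h (y + s *\<^sub>R v) - s * (v \<bullet> grad h y) - s\<^sup>2 * (B / 2 * (norm v)\<^sup>2)" for s
  have "q 1 \<le> q 0"
  proof (rule DERIV_nonpos_imp_nonincreasing[of 0 1 q])
    fix s :: real assume s: "0 \<le> s" "s \<le> 1"
    let ?D = "v \<bullet> grad h (y + s *\<^sub>R v) - v \<bullet> grad h y - 2 * s * (B / 2 * (norm v)\<^sup>2)"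
    have "(q has_real_derivative ?D) (at s)"
      unfolding q_def
      by (auto intro!: derivative_eq_intros GDERIV_along_line GDERIV_grad assms)
    moreover have "?D \<le> 0"
    proof -
      have "v \<bullet> grad h (y + s *\<^sub>R v) - v \<bullet> grad h y \<le> norm v * norm (grad h (y + s *\<^sub>R v) - grad h y)"
        by (metis inner_diff_right norm_cauchy_schwarz)
      also have "\<dots> \<le> norm v * (B * norm (s *\<^sub>R v))"
        using lipschitz_onD[OF lip, of "y + s *\<^sub>R v" y]
        by (intro mult_left_mono) (auto simp: dist_norm)
      finally show ?thesis using s by (simp add: power2_eq_square algebra_simps)
    qed
    ultimately show "\<exists>D. (q has_real_derivative D) (at s) \<and> D \<le> 0" by blast
  qed simp
  then show ?thesis by (simp add: q_def v_def)
qed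

lemma convex_gradient_inequality:
  fixes h :: "'a::real_inner \<Rightarrow> real"
  assumes "convex_on UNIV h" "continuously_differentiable h"
  shows "h y + (z - y) \<bullet> grad h y \<le> h z"
proof -
  define v where "v = z - y"
  have cv: "convex_on UNIV (\<lambda>s. h (y + s *\<^sub>R v))"
  proof (rule convex_onI)
    fix s r t :: real assume "0 < t" "t < 1"
    have "y + ((1 - t) *\<^sub>R s + t *\<^sub>R r) *\<^sub>R v = (1 - t) *\<^sub>R (y + s *\<^sub>R v) + t *\<^sub>R (y + r *\<^sub>R v)"
      by (simp add: algebra_simps)
    then show "h (y + ((1 - t) *\<^sub>R s + t *\<^sub>R r) *\<^sub>R v)
        \<le> (1 - t) * h (y + s *\<^sub>R v) + t * h (y + r *\<^sub>R v)"
      using convex_onD[OF assms(1), of t "y + s *\<^sub>R v" "y + r *\<^sub>R v"] \<open>0 < t\<close> \<open>t < 1\<close> by simp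
  qed simp
  have "((\<lambda>s. h (y + s *\<^sub>R v)) has_real_derivative v \<bullet> grad h y) (at 0)"
    using GDERIV_along_line[of h y 0 v "grad h y"] GDERIV_grad[OF assms(2), of y] by simp
  then have "(v \<bullet> grad h y) * (1 - 0) \<le> h (y + 1 *\<^sub>R v) - h (y + 0 *\<^sub>R v)"
    by (intro convex_on_imp_above_tangent[OF cv]) auto
  then show ?thesis by (simp add: v_def)
qed

section \<open>One accelerated proximal gradient step\<close>

text \<open>Strong convexity of the proximal subproblem, used without subgradients: comparing the
  minimiser with the point at parameter \<open>s\<close> on the segment towards \<open>z\<close> loses only a factor \<open>1 - s\<close>
  in the quadratic gain, and \<open>s\<close> may tend to \<open>0\<close>.\<close>
lemma proximal_three_point_inequality:
  fixes G :: "'a::real_inner \<Rightarrow> real"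
  assumes G: "convex_on D G" and x: "x \<in> D" and z: "z \<in> D"
    and min: "\<And>w. w \<in> D \<Longrightarrow>
      G x + x \<bullet> v + B / 2 * (norm (x - y))\<^sup>2 \<le> G w + w \<bullet> v + B / 2 * (norm (w - y))\<^sup>2"
  shows "G x + x \<bullet> v + B / 2 * (norm (x - y))\<^sup>2 + B / 2 * (norm (z - x))\<^sup>2
           \<le> G z + z \<bullet> v + B / 2 * (norm (z - y))\<^sup>2"
proof -
  define q where "q w = G w + w \<bullet> v + B / 2 * (norm (w - y))\<^sup>2" for w
  define A where "A = B / 2 * (norm (z - x))\<^sup>2"
  have "q x + (1 - s) * A \<le> q z" if s: "0 < s" "s < 1" for s
  proof -
    define w where "w = (1 - s) *\<^sub>R x + s *\<^sub>R z"
    have w: "w \<in> D" unfolding w_def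
      using convex_on_imp_convex[OF G] x z s by (intro convexD) auto
    have wG: "G w \<le> (1 - s) * G x + s * G z"
      unfolding w_def using convex_onD[OF G] s x z by simp
    have wq: "w \<bullet> v = (1 - s) * (x \<bullet> v) + s * (z \<bullet> v)"
      by (simp add: w_def inner_add_left)
    have nsq: "(norm (w - y))\<^sup>2 = (1 - s) * (norm (x - y))\<^sup>2 + s * (norm (z - y))\<^sup>2
        - s * (1 - s) * (norm (z - x))\<^sup>2"
      unfolding w_def power2_norm_eq_inner
      by (simp add: inner_simps inner_commute algebra_simps power2_eq_square)
    have "B / 2 * (norm (w - y))\<^sup>2 = (1 - s) * (B / 2 * (norm (x - y))\<^sup>2)
        + s * (B / 2 * (norm (z - y))\<^sup>2) - s * (1 - s) * A"
      unfolding A_def nsq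
      by (simp add: algebra_simps add_divide_distrib diff_divide_distrib)
    then have "q w \<le> (1 - s) * q x + s * q z - s * (1 - s) * A"
      using wG wq unfolding q_def by (simp add: algebra_simps)
    with min[OF w] have "s * (q x + (1 - s) * A) \<le> s * q z"
      unfolding q_def[symmetric] by (simp add: algebra_simps)
    then show ?thesis using s by simp
  qed
  then have "\<forall>\<^sub>F s in at_right 0. q x + (1 - s) * A \<le> q z"
    unfolding eventually_at_right_field by (intro exI[of _ 1]) auto
  moreover have "((\<lambda>s. q x + (1 - s) * A) \<longlongrightarrow> q x + (1 - 0) * A) (at_right 0)"
    by (intro tendsto_intros)
  ultimately have "q x + (1 - 0) * A \<le> q z"
    by (intro tendsto_upperbound[of _ _ "at_right (0::real)"]) auto
  then show ?thesis by (simp add: q_def A_def algebra_simps)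
qed

lemma prox_gradient_inequality:
  fixes G h :: "'a::real_inner \<Rightarrow> real"
  assumes "convex_on D G" and "x \<in> D" and "z \<in> D"
    and "\<And>w. w \<in> D \<Longrightarrow>
      G x + x \<bullet> v + B / 2 * (norm (x - y))\<^sup>2 \<le> G w + w \<bullet> v + B / 2 * (norm (w - y))\<^sup>2"
    and "h x \<le> h y + (x - y) \<bullet> v + B / 2 * (norm (x - y))\<^sup>2"
    and "h y + (z - y) \<bullet> v \<le> h z"
  shows "(h x + G x) + B / 2 * (norm (z - x))\<^sup>2 \<le> (h z + G z) + B / 2 * (norm (z - y))\<^sup>2"
  using proximal_three_point_inequality[OF assms(1-4)] assms(5,6)
  by (simp add: inner_diff_left)

text \<open>The proximal inequality is tested at the convex combination of the current iterate
  and \<open>u\<close> with weight \<open>1/t\<close> on \<open>u\<close>. The extrapolation that defines \<open>y\<close> is chosen exactly so that,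
  after scaling by \<open>t\<close>, the two squared distances become consecutive values of one sequence.\<close>
lemma fista_step:
  fixes \<Phi> :: "'a::real_inner \<Rightarrow> real"
  assumes \<Phi>: "convex_on D \<Phi>" and "x \<in> D" "u \<in> D" and t: "1 \<le> t"
    and prox: "\<And>z. z \<in> D \<Longrightarrow>
      \<Phi> x1 + B / 2 * (norm (z - x1))\<^sup>2 \<le> \<Phi> z + B / 2 * (norm (z - y))\<^sup>2"
    and y: "y = x + (inverse t * (t0 - 1)) *\<^sub>R (x - x0)"
  shows "t\<^sup>2 * (\<Phi> x1 - \<Phi> u) - (t\<^sup>2 - t) * (\<Phi> x - \<Phi> u)
    \<le> B / 2 * (norm (x0 + t0 *\<^sub>R (x - x0) - u))\<^sup>2 - B / 2 * (norm (x + t *\<^sub>R (x1 - x) - u))\<^sup>2"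
proof -
  define s where "s = inverse t"
  have s: "0 \<le> s" "s \<le> 1" "t * s = 1" using t by (auto simp: s_def field_simps)
  define z where "z = (1 - s) *\<^sub>R x + s *\<^sub>R u"
  have z: "z \<in> D" unfolding z_def
    using convex_on_imp_convex[OF \<Phi>] s assms(2,3) by (intro convexD) auto
  have "t *\<^sub>R (z - x1) = u - (x + t *\<^sub>R (x1 - x))"
    unfolding z_def using s(3) by (simp add: algebra_simps)
  then have nx: "t\<^sup>2 * (norm (z - x1))\<^sup>2 = (norm (x + t *\<^sub>R (x1 - x) - u))\<^sup>2"
    using t by (metis abs_of_nonneg norm_minus_commute norm_scaleR order_trans power_mult_distrib zero_le_one)
  have "t *\<^sub>R (z - y) = t *\<^sub>R x + (t * s) *\<^sub>R (u - x) - t *\<^sub>R x - (t * s * (t0 - 1)) *\<^sub>R (x - x0)"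
    unfolding z_def y s_def[symmetric] by (simp add: algebra_simps)
  also have "\<dots> = u - (x0 + t0 *\<^sub>R (x - x0))"
    unfolding s(3) by (simp add: algebra_simps)
  finally have ny: "t\<^sup>2 * (norm (z - y))\<^sup>2 = (norm (x0 + t0 *\<^sub>R (x - x0) - u))\<^sup>2"
    using t by (metis abs_of_nonneg norm_minus_commute norm_scaleR order_trans power_mult_distrib zero_le_one)
  have "\<Phi> z \<le> (1 - s) * \<Phi> x + s * \<Phi> u"
    unfolding z_def using convex_onD[OF \<Phi>] s assms(2,3) by simp
  then have "\<Phi> x1 + B / 2 * (norm (z - x1))\<^sup>2
      \<le> (1 - s) * \<Phi> x + s * \<Phi> u + B / 2 * (norm (z - y))\<^sup>2"
    using prox[OF z] by linarith
  from mult_left_mono[OF this, of "t\<^sup>2"]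
  have "t\<^sup>2 * \<Phi> x1 + B / 2 * (t\<^sup>2 * (norm (z - x1))\<^sup>2)
      \<le> (t\<^sup>2 - t * (t * s)) * \<Phi> x + t * (t * s) * \<Phi> u + B / 2 * (t\<^sup>2 * (norm (z - y))\<^sup>2)"
    by (simp add: algebra_simps power2_eq_square)
  then show ?thesis unfolding nx ny s(3) by (simp add: algebra_simps)
qed

section \<open>Decay of the energy\<close>

text \<open>Scalar form of the convergence argument. Here \<open>e\<close> and \<open>q\<close> stand for the excess of the inner
  and the outer objective at the iterates, \<open>d\<close> for the distance to the inner solution set and, up to
  a constant factor, \<open>R\<close> for the squared distance of the extrapolated point to a fixed solution and
  \<open>\<Delta>\<close> for the squared step length. Assumption \<open>step\<close> is the descent estimate against that solution and yields summability
  of \<open>t * E\<close>; assumption \<open>mono\<close> is the one against the previous iterate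
  and upgrades this to decay of \<open>t\<^sup>2 * E\<close>. The increments \<open>t\<^sub>n\<^sub>+\<^sub>1 (\<alpha>\<^sub>n - \<alpha>\<^sub>n\<^sub>+\<^sub>1)\<close> only need to be of
  order \<open>\<alpha>\<^sub>n\<^sub>+\<^sub>1\<close>, since they multiply \<open>d\<close>, whose square is controlled by \<open>E\<close>.\<close>
lemma energy_decay:
  fixes \<alpha> t e q d R \<Delta> :: "nat \<Rightarrow> real" and L \<tau> K c :: real
  assumes \<tau>: "0 < \<tau>" and c: "0 < c"
    and \<alpha>: "\<And>n. 0 \<le> \<alpha> n" and \<alpha>_dec: "\<And>n. \<alpha> (Suc n) \<le> \<alpha> n"
    and t1: "\<And>n. 1 \<le> t n" and t_mono: "\<And>n. t n \<le> t (Suc n)"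
    and t_slack: "\<And>n. (t (Suc n))\<^sup>2 - t (Suc n) + c * t (Suc n) \<le> (t n)\<^sup>2"
    and t_growth: "\<And>n. (t (Suc n))\<^sup>2 \<le> (t n)\<^sup>2 + t (Suc n)"
    and \<alpha>_slow: "\<And>n. t (Suc n) * (\<alpha> n - \<alpha> (Suc n)) \<le> K * \<alpha> (Suc n)"
    and sum: "summable (\<lambda>n. t n * (\<alpha> n)\<^sup>2)"
    and div: "\<not> summable (\<lambda>n. 1 / t n)"
    and L: "0 \<le> L" and d: "\<And>n. 0 \<le> d n"
    and e: "\<And>n. \<tau> * (d n)\<^sup>2 \<le> e n" and q: "\<And>n. - L * d n \<le> q n"
    and R: "\<And>n. 0 \<le> R n" and \<Delta>: "\<And>n. 0 \<le> \<Delta> n"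
    and step: "\<And>n. (t (Suc n))\<^sup>2 * (e (Suc n) + \<alpha> (Suc n) * q (Suc n))
      - ((t (Suc n))\<^sup>2 - t (Suc n)) * (e n + \<alpha> (Suc n) * q n) \<le> R n - R (Suc n)"
    and mono: "\<And>n. (t (Suc n))\<^sup>2 * (e (Suc n) + \<alpha> (Suc n) * q (Suc n) + \<Delta> (Suc n))
      \<le> (t (Suc n))\<^sup>2 * (e n + \<alpha> (Suc n) * q n) + (t n - 1)\<^sup>2 * \<Delta> n"
  defines "E \<equiv> \<lambda>n. e n + \<alpha> n * q n + L\<^sup>2 / (2 * \<tau>) * (\<alpha> n)\<^sup>2"
  shows "(\<lambda>n. (t n)\<^sup>2 * E n) \<longlonglongrightarrow> 0"
    and "(\<lambda>n. (t n)\<^sup>2 * \<Delta> n) \<longlonglongrightarrow> 0"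
    and "convergent R"
    and "\<And>n. 0 \<le> E n"
proof -
  define C where "C = L\<^sup>2 / (2 * \<tau>)"
  define \<eta> where "\<eta> = c / 2"
  define M where "M = (K * L)\<^sup>2 / (2 * (\<eta> * \<tau>))"
  have E_C: "E n = e n + \<alpha> n * q n + C * (\<alpha> n)\<^sup>2" for n
    by (simp add: E_def C_def)
  have \<eta>: "0 < \<eta>" using c by (simp add: \<eta>_def)
  have M: "0 \<le> M" and C: "0 \<le> C" using \<eta> \<tau> by (auto simp: M_def C_def)
  have young: "s * r \<le> p / 2 * r\<^sup>2 + s\<^sup>2 / (2 * p)" if "0 < p" for p s r :: real
  proof -
    have "0 \<le> (p * r - s)\<^sup>2 / (2 * p)" using that by simp
    also have "\<dots> = p / 2 * r\<^sup>2 + s\<^sup>2 / (2 * p) - s * r"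
      using that by (simp add: field_simps power2_eq_square)
    finally show ?thesis by simp
  qed
  have E_lower: "\<tau> / 2 * (d n)\<^sup>2 \<le> E n" for n
  proof -
    have "\<alpha> n * (- L * d n) \<le> \<alpha> n * q n"
      using q \<alpha> by (intro mult_left_mono) auto
    moreover have "(\<alpha> n * L) * d n \<le> \<tau> / 2 * (d n)\<^sup>2 + (\<alpha> n * L)\<^sup>2 / (2 * \<tau>)"
      by (rule young[OF \<tau>])
    moreover have "(\<alpha> n * L)\<^sup>2 / (2 * \<tau>) = L\<^sup>2 / (2 * \<tau>) * (\<alpha> n)\<^sup>2"
      by (simp add: power_mult_distrib)
    ultimately show ?thesis using e[of n] unfolding E_def by (simp add: algebra_simps)
  qed
  have "0 \<le> \<tau> / 2 * (d n)\<^sup>2" for n using \<tau> by simp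
  then show E0: "0 \<le> E n" for n using E_lower order_trans by blast
  \<comment> \<open>\<open>S n\<close> is the energy at the same iterate as \<open>E n\<close>, but with the next regularisation weight.\<close>
  define S where "S n = e n + \<alpha> (Suc n) * q n + C * (\<alpha> (Suc n))\<^sup>2" for n
  have S_le: "t (Suc n) * S n \<le> (t (Suc n) + \<eta>) * E n + M * (\<alpha> (Suc n))\<^sup>2" for n
  proof -
    let ?T = "t (Suc n)" and ?\<delta> = "\<alpha> n - \<alpha> (Suc n)"
    have T: "0 \<le> ?T" using t1[of "Suc n"] by simp
    have "?\<delta> * (- L * d n) \<le> ?\<delta> * q n"
      using q \<alpha>_dec by (intro mult_left_mono) auto
    moreover have "C * (\<alpha> (Suc n))\<^sup>2 \<le> C * (\<alpha> n)\<^sup>2"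
      using C \<alpha> \<alpha>_dec by (intro mult_left_mono power_mono) auto
    ultimately have "S n \<le> E n + ?\<delta> * (L * d n)"
      unfolding S_def E_C by (simp add: algebra_simps)
    then have "?T * S n \<le> ?T * E n + (?T * ?\<delta>) * (L * d n)"
      using mult_left_mono[OF _ T] by (fastforce simp: algebra_simps)
    also have "(?T * ?\<delta>) * (L * d n) \<le> (K * \<alpha> (Suc n)) * (L * d n)"
      using \<alpha>_slow L d by (intro mult_right_mono) auto
    also have "\<dots> = (K * L * \<alpha> (Suc n)) * d n" by simp
    also have "\<dots> \<le> \<eta> * \<tau> / 2 * (d n)\<^sup>2 + (K * L * \<alpha> (Suc n))\<^sup>2 / (2 * (\<eta> * \<tau>))"
      using \<eta> \<tau> by (intro young) simp
    also have "\<dots> \<le> \<eta> * E n + M * (\<alpha> (Suc n))\<^sup>2"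
      using mult_left_mono[OF E_lower[of n], of \<eta>] \<eta>
      by (simp add: M_def power_mult_distrib)
    finally show ?thesis by (simp add: algebra_simps)
  qed
  define b where "b n = t (Suc n) * (\<alpha> (Suc n))\<^sup>2" for n
  have b_sum: "summable b"
    using sum unfolding b_def by (subst summable_Suc_iff)
  have b0: "0 \<le> b n" for n using t1[of "Suc n"] by (simp add: b_def)

  \<comment> \<open>First Lyapunov function. With \<open>\<eta> = c / 2\<close>, replacing \<open>E n\<close> by \<open>S n\<close> uses up half of the slack;
    the other half makes \<open>t * E\<close> summable.\<close>
  define V where "V n = (t n)\<^sup>2 * E n + R n" for n
  have V_step: "V (Suc n) \<le> V n - \<eta> * t (Suc n) * E n + (C + M) * b n" for n
  proof -
    let ?T = "t (Suc n)"
    have T: "1 \<le> ?T" by (rule t1)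
    have "V (Suc n) \<le> (?T - 1) * (?T * S n) + C * b n + R n"
      using step[of n] unfolding V_def E_C S_def b_def
      by (simp add: algebra_simps power2_eq_square)
    also have "(?T - 1) * (?T * S n) \<le> (?T - 1) * ((?T + \<eta>) * E n + M * (\<alpha> (Suc n))\<^sup>2)"
      using S_le T by (intro mult_left_mono) auto
    also have "\<dots> = (?T\<^sup>2 - ?T + \<eta> * ?T) * E n - \<eta> * E n + M * b n - M * (\<alpha> (Suc n))\<^sup>2"
      unfolding b_def by (simp add: algebra_simps power2_eq_square)
    also have "\<dots> \<le> (?T\<^sup>2 - ?T + \<eta> * ?T) * E n + M * b n"
      using mult_nonneg_nonneg[OF less_imp_le[OF \<eta>] E0[of n]]
        mult_nonneg_nonneg[OF M zero_le_power2[of "\<alpha> (Suc n)"]] by linarith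
    also have "\<dots> \<le> ((t n)\<^sup>2 - \<eta> * ?T) * E n + M * b n"
      using t_slack[of n] E0 unfolding \<eta>_def by (intro add_right_mono mult_right_mono) auto
    finally show ?thesis unfolding V_def by (simp add: algebra_simps)
  qed
  have V0: "0 \<le> V n" for n using E0 R by (simp add: V_def)
  have TE: "0 \<le> t (Suc n) * E n" for n
    using t1[of "Suc n"] E0 by simp
  have V: "convergent V" "summable (\<lambda>n. \<eta> * t (Suc n) * E n)"
    using quasi_fejer_convergence[of V "\<lambda>n. \<eta> * t (Suc n) * E n" "\<lambda>n. (C + M) * b n"]
      V_step V0 TE \<eta> b_sum by (auto simp: mult.assoc intro: summable_mult)
  then have TE_sum: "summable (\<lambda>n. t (Suc n) * E n)"
    using \<eta> by (simp add: mult.assoc summable_cmult_iff)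

  \<comment> \<open>Second Lyapunov function. It grows by at most multiples of \<open>t * E\<close> and \<open>b\<close>, both summable,
    and its decrease makes \<open>t * \<Delta>\<close> summable.\<close>
  define W where "W n = (t n)\<^sup>2 * (E n + \<Delta> n)" for n
  have W_step: "W (Suc n) \<le> W n - t n * \<Delta> n + ((1 + \<eta>) * (t (Suc n) * E n) + (C + M) * b n)" for n
  proof -
    let ?T = "t (Suc n)"
    have T: "1 \<le> ?T" by (rule t1)
    have "W (Suc n) \<le> ?T * (?T * S n) + (t n - 1)\<^sup>2 * \<Delta> n"
      using mono[of n] unfolding W_def E_C S_def
      by (simp add: algebra_simps power2_eq_square)
    also have "?T * (?T * S n) \<le> ?T * ((?T + \<eta>) * E n + M * (\<alpha> (Suc n))\<^sup>2)"
      using S_le T by (intro mult_left_mono) auto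
    also have "\<dots> = ?T\<^sup>2 * E n + \<eta> * (?T * E n) + M * b n"
      unfolding b_def by (simp add: algebra_simps power2_eq_square)
    also have "?T\<^sup>2 * E n \<le> ((t n)\<^sup>2 + ?T) * E n"
      using t_growth E0 by (intro mult_right_mono) auto
    also have "(t n - 1)\<^sup>2 * \<Delta> n \<le> ((t n)\<^sup>2 - t n) * \<Delta> n"
      using t1[of n] \<Delta> by (intro mult_right_mono) (auto simp: power2_eq_square algebra_simps)
    finally have "W (Suc n) \<le> W n - t n * \<Delta> n + ((1 + \<eta>) * (?T * E n) + M * b n)"
      unfolding W_def by (simp add: algebra_simps)
    moreover have "0 \<le> C * b n" using C b0 by simp
    ultimately show ?thesis by (simp add: algebra_simps)
  qed
  have W0: "0 \<le> W n" for n using E0 \<Delta> by (simp add: W_def)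
  have t\<Delta>: "0 \<le> t n * \<Delta> n" for n using t1[of n] \<Delta>[of n] by simp
  have "summable (\<lambda>n. (1 + \<eta>) * (t (Suc n) * E n) + (C + M) * b n)"
    using TE_sum b_sum by (intro summable_add summable_mult)
  note W = quasi_fejer_convergence[of W "\<lambda>n. t n * \<Delta> n", OF W0 t\<Delta> this W_step]
  have W_sum: "summable (\<lambda>n. W n / t n)"
  proof (rule summable_comparison_test')
    show "summable (\<lambda>n. t (Suc n) * E n + t n * \<Delta> n)"
      using TE_sum W(2) by (rule summable_add)
    show "norm (W n / t n) \<le> t (Suc n) * E n + t n * \<Delta> n" for n
    proof -
      have "W n / t n = t n * E n + t n * \<Delta> n"
        using t1[of n] unfolding W_def power2_eq_square
        by (simp add: distrib_left add_divide_distrib)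
      moreover have "t n * E n \<le> t (Suc n) * E n"
        using t_mono E0 by (intro mult_right_mono) auto
      moreover have "0 \<le> t n * E n" using t1[of n] E0[of n] by simp
      ultimately show ?thesis using t\<Delta>[of n] by simp
    qed
  qed
  \<comment> \<open>\<open>W\<close> converges and \<open>W / t\<close> is summable although \<open>1 / t\<close> is not, so the limit is zero.\<close>
  obtain l where l: "W \<longlonglongrightarrow> l" using W(1) by (auto simp: convergent_def)
  have "0 \<le> l" using l W0 by (auto intro: LIMSEQ_le_const)
  have "l = 0"
  proof (rule ccontr)
    assume "l \<noteq> 0"
    with \<open>0 \<le> l\<close> have "l / 2 < l" by simp
    then have "\<forall>\<^sub>F n in sequentially. l / 2 < W n" by (rule order_tendstoD[OF l])
    then obtain N where N: "\<And>n. N \<le> n \<Longrightarrow> l / 2 < W n"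
      by (auto simp: eventually_sequentially)
    have "summable (\<lambda>n. 1 / t n)"
    proof (rule summable_comparison_test')
      show "summable (\<lambda>n. 2 / l * (W n / t n))" using W_sum by (rule summable_mult)
      show "norm (1 / t n) \<le> 2 / l * (W n / t n)" if "N \<le> n" for n
        using N[OF that] t1[of n] \<open>l / 2 < l\<close> by (simp add: field_simps)
    qed
    with div show False by contradiction
  qed
  with l have W_lim: "W \<longlonglongrightarrow> 0" by simp
  have tE: "0 \<le> (t n)\<^sup>2 * E n" "0 \<le> (t n)\<^sup>2 * \<Delta> n" for n using E0 \<Delta> by auto
  show tE_lim: "(\<lambda>n. (t n)\<^sup>2 * E n) \<longlonglongrightarrow> 0"
    by (rule tendsto_sandwich[OF _ _ tendsto_const W_lim])
      (use tE in \<open>auto simp: W_def distrib_left\<close>)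
  show "(\<lambda>n. (t n)\<^sup>2 * \<Delta> n) \<longlonglongrightarrow> 0"
    by (rule tendsto_sandwich[OF _ _ tendsto_const W_lim])
      (use tE in \<open>auto simp: W_def distrib_left\<close>)
  have "convergent (\<lambda>n. V n - (t n)\<^sup>2 * E n)"
    using V(1) tE_lim by (intro convergent_diff) (auto simp: convergent_def)
  then show "convergent R" by (simp add: V_def)
qed

section \<open>Exact penalty\<close>

lemma convex_locally_bounded_above:
  fixes h :: "'a::euclidean_space \<Rightarrow> real"
  assumes "convex_on S h" and "u \<in> interior S"
  obtains r M where "0 < r" and "cball u r \<subseteq> S" and "\<And>v. v \<in> cball u r \<Longrightarrow> h v \<le> M"
proof -
  obtain r where r: "0 < r" "cball u r \<subseteq> interior S"
    using assms(2) open_contains_cball by (metis open_interior)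
  have "convex_on (interior S) h"
    using assms(1) by (meson convex_on_subset convex_on_imp_convex convex_interior interior_subset)
  then have "continuous_on (cball u r) h"
    using convex_on_continuous[OF open_interior] continuous_on_subset r(2) by blast
  then have "compact (h ` cball u r)"
    by (rule compact_continuous_image) (rule compact_cball)
  then have "bdd_above (h ` cball u r)"
    by (intro bounded_imp_bdd_above compact_imp_bounded)
  then obtain M where "\<And>v. v \<in> cball u r \<Longrightarrow> h v \<le> M"
    unfolding bdd_above_def by blast
  with that r interior_subset show thesis by (meson subset_trans)
qed

text \<open>For \<open>p\<close> in \<open>X\<close>, start at \<open>u\<close> and move by \<open>r\<close> in the direction from \<open>x\<close> to \<open>p\<close>. The
  resulting point \<open>v\<close> stays in the ball on which \<open>h \<le> M\<close>, and the segment from \<open>x\<close> to \<open>v\<close> crosses the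
  segment from \<open>p\<close> to \<open>u\<close>, hence \<open>X\<close>. Convexity of \<open>h\<close> on the first segment bounds \<open>h x\<close> from below.
  Taking the infimum over \<open>p\<close> gives the distance.\<close>
lemma slater_exact_penalty:
  fixes h :: "'a::real_normed_vector \<Rightarrow> real"
  assumes h: "convex_on S h" and X: "convex X" "u \<in> X"
    and r: "0 < r" "cball u r \<subseteq> S" and M: "\<And>v. v \<in> cball u r \<Longrightarrow> h v \<le> M"
    and min: "\<And>v. v \<in> X \<Longrightarrow> v \<in> S \<Longrightarrow> h u \<le> h v" and x: "x \<in> S"
  shows "h u - (M - h u) / r * infdist x X \<le> h x"
proof -
  define G where "G = (M - h u) / r"
  have "h u \<le> M" using M r(1) by simp
  then have G: "0 \<le> G" using r by (simp add: G_def)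
  have "h u - h x \<le> G * dist x p" if p: "p \<in> X" for p
  proof (cases "x = p")
    case True
    with min x p show ?thesis by simp
  next
    case False
    define \<rho> where "\<rho> = norm (x - p)"
    have \<rho>: "0 < \<rho>" using False by (simp add: \<rho>_def)
    \<comment> \<open>The weight at which the two segments cross, by similar triangles.\<close>
    define s where "s = \<rho> / (\<rho> + r)"
    have s: "0 \<le> s" "s \<le> 1" and sr: "s * r = (1 - s) * \<rho>" and s1: "0 < 1 - s"
      using \<rho> r by (auto simp: s_def field_simps)
    define v where "v = u + (r / \<rho>) *\<^sub>R (p - x)"
    have v: "v \<in> cball u r"
      using \<rho> r by (simp add: v_def dist_norm \<rho>_def norm_minus_commute)
    define w where "w = (1 - s) *\<^sub>R x + s *\<^sub>R v"
    have "s * (r / \<rho>) = 1 - s" using sr \<rho> by (simp add: field_simps)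
    moreover have "w = (1 - s) *\<^sub>R x + s *\<^sub>R u + (s * (r / \<rho>)) *\<^sub>R (p - x)"
      unfolding w_def v_def by (simp add: algebra_simps)
    ultimately have "w = (1 - s) *\<^sub>R x + s *\<^sub>R u + (1 - s) *\<^sub>R (p - x)"
      by metis
    then have "w = (1 - s) *\<^sub>R p + s *\<^sub>R u"
      by (simp add: algebra_simps)
    then have "w \<in> X" using X p s by (simp add: convexD)
    moreover have "w \<in> S" unfolding w_def
      using convex_on_imp_convex[OF h] x v r s by (intro convexD) auto
    ultimately have "h u \<le> h w" by (rule min)
    also have "h w \<le> (1 - s) * h x + s * h v"
      unfolding w_def using convex_onD[OF h] s x v r by blast
    also have "\<dots> \<le> (1 - s) * h x + s * M"
      using M[OF v] s by (simp add: mult_left_mono)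
    finally have "(1 - s) * (h u - h x) \<le> s * (M - h u)"
      by (simp add: algebra_simps)
    also have "\<dots> = (s * r) * G" using r by (simp add: G_def)
    also have "\<dots> = (1 - s) * (G * \<rho>)" unfolding sr by simp
    finally show ?thesis using s1 by (simp add: \<rho>_def dist_norm)
  qed
  then have le: "h u - h x \<le> G * dist x p" if "p \<in> X" for p using that .
  have "h u - h x \<le> G * infdist x X"
  proof (cases "G = 0")
    case True
    with le[OF X(2)] show ?thesis by simp
  next
    case False
    with G have G1: "0 < G" by simp
    have "(h u - h x) / G \<le> (INF p\<in>X. dist x p)"
      using X(2) le G1 by (intro cINF_greatest) (auto simp: field_simps)
    also have "\<dots> = infdist x X"
      using X(2) infdist_notempty[of X x] by (metis empty_iff)
    finally have "(h u - h x) / G \<le> infdist x X" .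
    with G1 show ?thesis by (simp add: field_simps)
  qed
  then show ?thesis by (simp add: G_def)
qed

section \<open>The parameters of the algorithm\<close>

text \<open>With \<open>N = n + a\<close>, both the slow variation of \<open>\<alpha>\<close> and the lower bound on \<open>t\<^sup>2 * \<alpha>\<close> come from
  comparing \<open>powr \<gamma>\<close> with the square. The slack constant \<open>1 - 2 / a\<close> is positive because \<open>a > 2\<close>.\<close>
lemma stepsize_estimates:
  fixes a \<gamma> :: real and n :: nat
  assumes a: "2 < a" and \<gamma>: "1 < \<gamma>" "\<gamma> < 2"
  defines "\<alpha> \<equiv> \<lambda>n. (real n + a) powr (- \<gamma>)" and "t \<equiv> \<lambda>n. (real n + a) / a"
  shows "0 < \<alpha> n" and "\<alpha> n \<le> 1" and "\<alpha> (Suc n) \<le> \<alpha> n" and "1 \<le> t n" and "t n \<le> t (Suc n)"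
    and "(t (Suc n))\<^sup>2 - t (Suc n) + (1 - 2 / a) * t (Suc n) \<le> (t n)\<^sup>2"
    and "(t (Suc n))\<^sup>2 \<le> (t n)\<^sup>2 + t (Suc n)"
    and "t (Suc n) * (\<alpha> n - \<alpha> (Suc n)) \<le> 6 * \<alpha> (Suc n)"
    and "1 \<le> a\<^sup>2 * ((t n)\<^sup>2 * \<alpha> n)"
proof -
  define N where "N = real n + a"
  have N: "2 < N" "real (Suc n) + a = N + 1" "real n + a = N" using a by (auto simp: N_def)
  show "0 < \<alpha> n" using a by (simp add: \<alpha>_def)
  have "N powr (- \<gamma>) \<le> N powr 0" using N \<gamma> by (intro powr_mono) auto
  then show "\<alpha> n \<le> 1" using N by (simp add: \<alpha>_def)
  show "\<alpha> (Suc n) \<le> \<alpha> n"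
    unfolding \<alpha>_def N using N \<gamma> by (intro powr_mono2') auto
  show "1 \<le> t n" "t n \<le> t (Suc n)" using a by (auto simp: t_def field_simps)
  show "(t (Suc n))\<^sup>2 - t (Suc n) + (1 - 2 / a) * t (Suc n) \<le> (t n)\<^sup>2"
    unfolding t_def N using a N(1) by (simp add: field_simps power2_eq_square)
  have "2 * N + 1 \<le> 2 * (N + 1)" by simp
  also have "\<dots> \<le> a * (N + 1)" using a N by (intro mult_right_mono) auto
  finally have "(2 * N + 1) / a\<^sup>2 \<le> a * (N + 1) / a\<^sup>2"
    by (intro divide_right_mono) auto
  also have "a * (N + 1) / a\<^sup>2 = (N + 1) / a"
    using a by (simp add: power2_eq_square)
  also have "(2 * N + 1) / a\<^sup>2 = ((N + 1) / a)\<^sup>2 - (N / a)\<^sup>2"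
    by (simp add: power_divide diff_divide_distrib[symmetric] power2_eq_square algebra_simps)
  finally show "(t (Suc n))\<^sup>2 \<le> (t n)\<^sup>2 + t (Suc n)"
    unfolding t_def N by simp
  show "t (Suc n) * (\<alpha> n - \<alpha> (Suc n)) \<le> 6 * \<alpha> (Suc n)"
  proof -
    have "((N + 1) / N) powr \<gamma> \<le> ((N + 1) / N) powr 2"
      using N \<gamma> by (intro powr_mono) auto
    also have "\<dots> = ((N + 1) / N)\<^sup>2" using N by (simp add: powr_numeral)
    also have "\<dots> \<le> 1 + 3 / N"
      using N by (simp add: field_simps power2_eq_square)
    finally have "(N + 1) powr (- \<gamma>) * ((N + 1) / N) powr \<gamma> \<le> (N + 1) powr (- \<gamma>) * (1 + 3 / N)"
      using N by (intro mult_left_mono) auto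
    moreover have "(N + 1) powr (- \<gamma>) * ((N + 1) / N) powr \<gamma> = N powr (- \<gamma>)"
      using N by (simp add: powr_divide powr_minus field_simps)
    ultimately have "N powr (- \<gamma>) - (N + 1) powr (- \<gamma>) \<le> 3 / N * (N + 1) powr (- \<gamma>)"
      by (simp add: algebra_simps)
    then have "(N + 1) / a * (N powr (- \<gamma>) - (N + 1) powr (- \<gamma>))
        \<le> (N + 1) / a * (3 / N * (N + 1) powr (- \<gamma>))"
      using a N by (intro mult_left_mono) auto
    also have "\<dots> = ((N + 1) / a * (3 / N)) * (N + 1) powr (- \<gamma>)" by simp
    also have "\<dots> \<le> 6 * (N + 1) powr (- \<gamma>)"
    proof (intro mult_right_mono)
      have "(N + 1) * 3 \<le> 6 * (1 * N)" using N by simp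
      also have "\<dots> \<le> 6 * (a * N)" using N a by (intro mult_left_mono mult_right_mono) auto
      finally show "(N + 1) / a * (3 / N) \<le> 6" using a N by (simp add: field_simps)
    qed simp
    finally show ?thesis unfolding t_def \<alpha>_def N .
  qed
  have "1 = N powr 0" using N by simp
  also have "\<dots> \<le> N powr (2 - \<gamma>)" using N \<gamma> by (intro powr_mono) auto
  also have "\<dots> = N\<^sup>2 * N powr (- \<gamma>)"
    using N by (simp add: powr_diff powr_minus powr_numeral divide_inverse)
  finally show "1 \<le> a\<^sup>2 * ((t n)\<^sup>2 * \<alpha> n)"
    using a by (simp add: t_def \<alpha>_def N power_divide)
qed

text \<open>The first series has terms of order \<open>n powr (1 - 2 * \<gamma>)\<close>; its convergence is the reason for \<open>\<gamma> > 1\<close>.\<close>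
lemma stepsize_series:
  fixes a :: nat and \<gamma> :: real
  assumes a: "0 < a" and \<gamma>: "1 < \<gamma>"
  shows "summable (\<lambda>n. (real n + real a) / real a * ((real n + real a) powr (- \<gamma>))\<^sup>2)"
    and "\<not> summable (\<lambda>n. 1 / ((real n + real a) / real a))"
proof -
  have "summable (\<lambda>n. real n powr (1 - 2 * \<gamma>))"
    using \<gamma> by (simp add: summable_real_powr_iff)
  then have scaled: "summable (\<lambda>n. real (n + a) powr (1 - 2 * \<gamma>) / real a)"
    by (intro summable_divide) (simp add: summable_iff_shift[of "\<lambda>n. real n powr (1 - 2 * \<gamma>)"] del: of_nat_add)
  have term_eq: "real (n + a) powr (1 - 2 * \<gamma>) / real a
      = (real n + real a) / real a * ((real n + real a) powr (- \<gamma>))\<^sup>2" for n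
  proof -
    have "real (n + a) powr (1 - 2 * \<gamma>) = real (n + a) powr 1 * (real (n + a) powr (- \<gamma>))\<^sup>2"
      unfolding power2_eq_square powr_add[symmetric] by simp
    then show ?thesis using a by simp
  qed
  show "summable (\<lambda>n. (real n + real a) / real a * ((real n + real a) powr (- \<gamma>))\<^sup>2)"
    using scaled unfolding term_eq .
  show "\<not> summable (\<lambda>n. 1 / ((real n + real a) / real a))"
  proof
    assume "summable (\<lambda>n. 1 / ((real n + real a) / real a))"
    then have "summable (\<lambda>n. 1 / real a * (1 / ((real n + real a) / real a)))"
      by (rule summable_mult)
    then have "summable (\<lambda>n. inverse (real (n + a)))"
      using a by (simp add: inverse_eq_divide)
    then have "summable (\<lambda>n. inverse (real n))"
      using summable_iff_shift[of "\<lambda>n. inverse (real n)" a] by blast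
    then show False using not_summable_harmonic[where 'a = real] by blast
  qed
qed

section \<open>Convergence of the iterates\<close>

text \<open>Distances to points of \<open>Z\<close> converge, hence the sequence is bounded and has a cluster point \<open>l\<close>
  in \<open>Z\<close>; the distance to \<open>l\<close> converges and vanishes along a subsequence.\<close>
lemma opial:
  fixes x :: "nat \<Rightarrow> 'a::euclidean_space"
  assumes "Z \<noteq> {}" and dist: "\<And>u. u \<in> Z \<Longrightarrow> convergent (\<lambda>n. norm (x n - u))"
    and cluster: "\<And>r l. strict_mono (r :: nat \<Rightarrow> nat) \<Longrightarrow> (\<lambda>n. x (r n)) \<longlonglongrightarrow> l \<Longrightarrow> l \<in> Z"
  shows "\<exists>l\<in>Z. x \<longlonglongrightarrow> l"
proof -
  obtain u where "u \<in> Z" using assms(1) by blast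
  then have "Bseq (\<lambda>n. norm (x n - u))" using dist convergent_imp_Bseq by blast
  then have "Bseq (\<lambda>n. x n - u)" by (simp add: Bseq_def)
  then have "Bseq x" using Bseq_add[of "\<lambda>n. x n - u" u] by simp
  then have "bounded (range x)" by (simp add: Bseq_eq_bounded)
  then obtain l r where r: "strict_mono (r :: nat \<Rightarrow> nat)" and l: "(x \<circ> r) \<longlonglongrightarrow> l"
    using bounded_imp_convergent_subsequence by blast
  have lZ: "l \<in> Z" using cluster[OF r] l by (simp add: comp_def)
  then obtain c where c: "(\<lambda>n. norm (x n - l)) \<longlonglongrightarrow> c" using dist by (auto simp: convergent_def)
  have "(\<lambda>n. norm ((x \<circ> r) n - l)) \<longlonglongrightarrow> norm (l - l)"
    using l by (intro tendsto_intros)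
  moreover have "(\<lambda>n. norm ((x \<circ> r) n - l)) \<longlonglongrightarrow> c"
    using LIMSEQ_subseq_LIMSEQ[OF c r] by (simp add: comp_def)
  ultimately have "c = 0" using LIMSEQ_unique by fastforce
  with c have "x \<longlonglongrightarrow> l" by (simp add: LIM_zero_iff tendsto_norm_zero_iff)
  with lZ show ?thesis by blast
qed

text \<open>Convergence of the regularised accelerated scheme for real-valued objectives on a convex set \<open>D\<close>.
  The first iterate need not lie in \<open>D\<close>, so the energy is only followed from \<open>x (Suc 0)\<close> on.
  The closedness assumption on \<open>Z\<close> is what lower semicontinuity of the objectives provides.\<close>
lemma regularized_fista_converges:
  fixes x y :: "nat \<Rightarrow> 'a::euclidean_space" and \<phi> \<omega> :: "'a \<Rightarrow> real" and \<alpha> t d :: "nat \<Rightarrow> real"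
  assumes convex: "convex_on D \<phi>" "convex_on D \<omega>" and \<beta>: "0 < \<beta>"
    and xD: "\<And>n. x (Suc n) \<in> D"
    and prox: "\<And>n z. z \<in> D \<Longrightarrow>
      \<phi> (x (Suc n)) + \<alpha> n * \<omega> (x (Suc n)) + \<beta> / 2 * (norm (z - x (Suc n)))\<^sup>2
        \<le> \<phi> z + \<alpha> n * \<omega> z + \<beta> / 2 * (norm (z - y n))\<^sup>2"
    and y: "\<And>n. y (Suc n) = x (Suc n) + (inverse (t (Suc n)) * (t n - 1)) *\<^sub>R (x (Suc n) - x n)"
    and \<tau>: "0 < \<tau>" and c: "0 < c" and L: "0 \<le> L" and d: "\<And>n. 0 \<le> d n"
    and \<alpha>: "\<And>n. 0 < \<alpha> n" and \<alpha>_dec: "\<And>n. \<alpha> (Suc n) \<le> \<alpha> n"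
    and t1: "\<And>n. 1 \<le> t n" and t_mono: "\<And>n. t n \<le> t (Suc n)"
    and t_slack: "\<And>n. (t (Suc n))\<^sup>2 - t (Suc n) + c * t (Suc n) \<le> (t n)\<^sup>2"
    and t_growth: "\<And>n. (t (Suc n))\<^sup>2 \<le> (t n)\<^sup>2 + t (Suc n)"
    and \<alpha>_slow: "\<And>n. t (Suc n) * (\<alpha> n - \<alpha> (Suc n)) \<le> K * \<alpha> (Suc n)"
    and \<alpha>_large: "\<And>n. 1 \<le> \<kappa> * ((t n)\<^sup>2 * \<alpha> n)"
    and sum: "summable (\<lambda>n. t n * (\<alpha> n)\<^sup>2)"
    and div: "\<not> summable (\<lambda>n. 1 / t n)"
    and growth: "\<And>n. \<tau> * (d n)\<^sup>2 \<le> \<phi> (x (Suc n)) - \<phi>'"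
    and penalty: "\<And>n. \<omega>' - L * d n \<le> \<omega> (x (Suc n))"
    and bound: "\<And>z. z \<in> D \<Longrightarrow> m \<le> \<omega> z"
    and Z: "Z \<noteq> {}" "\<And>u. u \<in> Z \<Longrightarrow> u \<in> D \<and> \<phi> u = \<phi>' \<and> \<omega> u = \<omega>'"
    and closed: "\<And>z l b. (\<And>n. z n \<in> D) \<Longrightarrow> z \<longlonglongrightarrow> l \<Longrightarrow> (\<lambda>n. \<phi> (z n)) \<longlonglongrightarrow> \<phi>' \<Longrightarrow>
      (\<And>n. \<omega> (z n) \<le> b n) \<Longrightarrow> b \<longlonglongrightarrow> \<omega>' \<Longrightarrow> l \<in> Z"
  shows "\<exists>l\<in>Z. x \<longlonglongrightarrow> l"
proof -
  define e where "e n = \<phi> (x (Suc n)) - \<phi>'" for n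
  define q where "q n = \<omega> (x (Suc n)) - \<omega>'" for n
  define \<Delta> where "\<Delta> n = \<beta> / 2 * (norm (x (Suc n) - x n))\<^sup>2" for n
  define R where "R u n = \<beta> / 2 * (norm (x n + t n *\<^sub>R (x (Suc n) - x n) - u))\<^sup>2" for u n
  define E where "E n = e n + \<alpha> n * q n + L\<^sup>2 / (2 * \<tau>) * (\<alpha> n)\<^sup>2" for n
  have \<Phi>: "convex_on D (\<lambda>z. \<phi> z + \<alpha> n * \<omega> z)" for n
    using convex \<alpha>[of n] by (intro convex_on_add convex_on_cmul) auto
  have step: "(t (Suc n))\<^sup>2 * (e (Suc n) + \<alpha> (Suc n) * q (Suc n))
      - ((t (Suc n))\<^sup>2 - t (Suc n)) * (e n + \<alpha> (Suc n) * q n) \<le> R u n - R u (Suc n)"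
    if u: "u \<in> Z" for u n
  proof -
    have "e k + \<alpha> (Suc n) * q k
        = (\<phi> (x (Suc k)) + \<alpha> (Suc n) * \<omega> (x (Suc k))) - (\<phi> u + \<alpha> (Suc n) * \<omega> u)" for k
      using Z(2)[OF u] by (simp add: e_def q_def algebra_simps)
    then show ?thesis
      unfolding R_def
      using fista_step[OF \<Phi>[of "Suc n"] xD[of n] _ t1[of "Suc n"] prox[of _ "Suc n"] y[of n], of u] Z(2)[OF u]
      by simp
  qed
  have mono: "(t (Suc n))\<^sup>2 * (e (Suc n) + \<alpha> (Suc n) * q (Suc n) + \<Delta> (Suc n))
      \<le> (t (Suc n))\<^sup>2 * (e n + \<alpha> (Suc n) * q n) + (t n - 1)\<^sup>2 * \<Delta> n" for n
  proof -
    have "x (Suc n) - y (Suc n) = (inverse (t (Suc n)) * (1 - t n)) *\<^sub>R (x (Suc n) - x n)"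
      unfolding y by (simp add: algebra_simps)
    then have "(norm (x (Suc n) - y (Suc n)))\<^sup>2 = (inverse (t (Suc n)) * (1 - t n))\<^sup>2 * (norm (x (Suc n) - x n))\<^sup>2"
      by (simp add: power_mult_distrib)
    moreover have "(t (Suc n))\<^sup>2 * (inverse (t (Suc n)) * (1 - t n))\<^sup>2 = (t n - 1)\<^sup>2"
      using t1[of "Suc n"] by (simp add: power_mult_distrib power_inverse power2_commute)
    ultimately have y_norm: "(t (Suc n))\<^sup>2 * (\<beta> / 2 * (norm (x (Suc n) - y (Suc n)))\<^sup>2) = (t n - 1)\<^sup>2 * \<Delta> n"
      by (simp add: \<Delta>_def) 
    have "e (Suc n) + \<alpha> (Suc n) * q (Suc n) + \<Delta> (Suc n)
        \<le> e n + \<alpha> (Suc n) * q n + \<beta> / 2 * (norm (x (Suc n) - y (Suc n)))\<^sup>2"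
      using prox[OF xD[of n], of "Suc n"]
      by (simp add: e_def q_def \<Delta>_def norm_minus_commute algebra_simps)
    from mult_left_mono[OF this, of "(t (Suc n))\<^sup>2"] y_norm show ?thesis
      by (simp add: distrib_left)
  qed
  have \<alpha>0: "0 \<le> \<alpha> n" for n using \<alpha>[of n] by simp
  have e: "\<tau> * (d n)\<^sup>2 \<le> e n" for n using growth by (simp add: e_def)
  have q: "- L * d n \<le> q n" for n using penalty[of n] by (simp add: q_def)
  have R0: "0 \<le> R u n" and \<Delta>0: "0 \<le> \<Delta> n" for u n
    using \<beta> by (simp_all add: R_def \<Delta>_def)
  note decay = energy_decay[where e = e and q = q and \<Delta> = \<Delta>,
      OF \<tau> c \<alpha>0 \<alpha>_dec t1 t_mono t_slack t_growth \<alpha>_slow sum div L d e q R0 \<Delta>0 step mono,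
      folded E_def]
  obtain u0 where u0: "u0 \<in> Z" using Z(1) by blast
  have E_lim: "(\<lambda>n. (t n)\<^sup>2 * E n) \<longlonglongrightarrow> 0" and \<Delta>_lim: "(\<lambda>n. (t n)\<^sup>2 * \<Delta> n) \<longlonglongrightarrow> 0"
    and E0: "0 \<le> E n" for n
    using decay[OF u0] by auto
  have tt: "1 \<le> (t n)\<^sup>2" for n using t1[of n] by simp
  have E_lim': "E \<longlonglongrightarrow> 0"
  proof (rule tendsto_sandwich[OF _ _ tendsto_const E_lim])
    show "\<forall>\<^sub>F n in sequentially. 0 \<le> E n" using E0 by simp
    show "\<forall>\<^sub>F n in sequentially. E n \<le> (t n)\<^sup>2 * E n"
      using mult_right_mono[OF tt E0] by simp
  qed
  \<comment> \<open>The outer excess is only weighted by \<open>\<alpha>\<close>, so the decay of \<open>E\<close> must outpace that of \<open>\<alpha>\<close>.\<close>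
  have q_le: "q n \<le> \<kappa> * ((t n)\<^sup>2 * E n)" for n
  proof -
    have "0 \<le> e n" using e[of n] \<tau> by (meson order_trans less_imp_le mult_nonneg_nonneg zero_le_power2)
    moreover have "0 \<le> L\<^sup>2 / (2 * \<tau>) * (\<alpha> n)\<^sup>2" using \<tau> by simp
    ultimately have "\<alpha> n * q n \<le> E n" by (simp add: E_def)
    also have "\<dots> \<le> (\<kappa> * ((t n)\<^sup>2 * \<alpha> n)) * E n"
      using mult_right_mono[OF \<alpha>_large E0] by simp
    finally have "\<alpha> n * q n \<le> \<alpha> n * (\<kappa> * ((t n)\<^sup>2 * E n))" by (simp add: mult_ac)
    then show ?thesis using \<alpha>[of n] by simp
  qed
  have "(\<lambda>n. (\<alpha> n)\<^sup>2) \<longlonglongrightarrow> 0"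
  proof (rule tendsto_sandwich[OF _ _ tendsto_const summable_LIMSEQ_zero[OF sum]])
    show "\<forall>\<^sub>F n in sequentially. (\<alpha> n)\<^sup>2 \<le> t n * (\<alpha> n)\<^sup>2"
      using mult_right_mono[OF t1 zero_le_power2] by simp
  qed simp
  then have \<alpha>_lim: "\<alpha> \<longlonglongrightarrow> 0"
    using tendsto_real_sqrt \<alpha>0 by fastforce
  have e_lim: "e \<longlonglongrightarrow> 0"
  proof (rule tendsto_sandwich[OF _ _ tendsto_const])
    show "\<forall>\<^sub>F n in sequentially. 0 \<le> e n"
      using e \<tau> by (meson always_eventually order_trans less_imp_le mult_nonneg_nonneg zero_le_power2)
    show "\<forall>\<^sub>F n in sequentially. e n \<le> E n - \<alpha> n * (m - \<omega>')"
    proof (rule always_eventually, rule allI)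
      fix n
      have "\<alpha> n * (m - \<omega>') \<le> \<alpha> n * q n"
        using bound[OF xD[of n]] \<alpha>0[of n] by (intro mult_left_mono) (auto simp: q_def)
      moreover have "0 \<le> L\<^sup>2 / (2 * \<tau>) * (\<alpha> n)\<^sup>2" using \<tau> by simp
      ultimately show "e n \<le> E n - \<alpha> n * (m - \<omega>')" by (simp add: E_def)
    qed
    show "(\<lambda>n. E n - \<alpha> n * (m - \<omega>')) \<longlonglongrightarrow> 0"
      using tendsto_diff[OF E_lim' tendsto_mult_right[OF \<alpha>_lim, of "m - \<omega>'"]] by simp
  qed
  have gap_lim: "(\<lambda>n. (t n - 1) *\<^sub>R (x (Suc n) - x n)) \<longlonglongrightarrow> 0"
  proof -
    have "(\<lambda>n. 2 / \<beta> * ((t n)\<^sup>2 * \<Delta> n)) \<longlonglongrightarrow> 2 / \<beta> * 0"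
      using \<Delta>_lim by (intro tendsto_intros)
    then have bound_lim: "(\<lambda>n. 2 / \<beta> * ((t n)\<^sup>2 * \<Delta> n)) \<longlonglongrightarrow> 0" by simp
    have "(\<lambda>n. (norm ((t n - 1) *\<^sub>R (x (Suc n) - x n)))\<^sup>2) \<longlonglongrightarrow> 0"
    proof (rule tendsto_sandwich[OF _ _ tendsto_const bound_lim])
      show "\<forall>\<^sub>F n in sequentially. (norm ((t n - 1) *\<^sub>R (x (Suc n) - x n)))\<^sup>2 \<le> 2 / \<beta> * ((t n)\<^sup>2 * \<Delta> n)"
      proof (rule always_eventually, rule allI)
        fix n
        have "(t n - 1)\<^sup>2 \<le> (t n)\<^sup>2" using t1[of n] by (intro power_mono) auto
        from mult_right_mono[OF this zero_le_power2, of "norm (x (Suc n) - x n)"]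
        show "(norm ((t n - 1) *\<^sub>R (x (Suc n) - x n)))\<^sup>2 \<le> 2 / \<beta> * ((t n)\<^sup>2 * \<Delta> n)"
          using \<beta> by (simp add: \<Delta>_def power_mult_distrib)
      qed
    qed simp
    from tendsto_real_sqrt[OF this]
    have "(\<lambda>n. norm ((t n - 1) *\<^sub>R (x (Suc n) - x n))) \<longlonglongrightarrow> 0" by (simp add: abs_mult)
    then show ?thesis by (rule tendsto_norm_zero_cancel)
  qed
  \<comment> \<open>The convergent quantity \<open>R u\<close> measures the distance to \<open>u\<close> of an extrapolated point, whose
    distance to the iterate tends to zero.\<close>
  have dist: "convergent (\<lambda>n. norm (x (Suc n) - u))" if u: "u \<in> Z" for u
  proof -
    define w where "w n = x n + t n *\<^sub>R (x (Suc n) - x n) - u" for n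
    obtain r where "R u \<longlonglongrightarrow> r" using decay(3)[OF u] by (auto simp: convergent_def)
    then have "(\<lambda>n. sqrt (2 / \<beta> * R u n)) \<longlonglongrightarrow> sqrt (2 / \<beta> * r)"
      by (intro tendsto_intros)
    moreover have "sqrt (2 / \<beta> * R u n) = norm (w n)" for n
      using \<beta> by (simp add: R_def w_def)
    ultimately have w: "(\<lambda>n. norm (w n)) \<longlonglongrightarrow> sqrt (2 / \<beta> * r)" by simp
    have "(\<lambda>n. norm (x (Suc n) - u) - norm (w n)) \<longlonglongrightarrow> 0"
    proof (rule Lim_null_comparison)
      show "(\<lambda>n. norm ((t n - 1) *\<^sub>R (x (Suc n) - x n))) \<longlonglongrightarrow> 0"
        using gap_lim by (rule tendsto_norm_zero)
      show "\<forall>\<^sub>F n in sequentially. norm (norm (x (Suc n) - u) - norm (w n))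
          \<le> norm ((t n - 1) *\<^sub>R (x (Suc n) - x n))"
      proof (rule always_eventually, rule allI)
        fix n
        have "w n - (x (Suc n) - u) = (t n - 1) *\<^sub>R (x (Suc n) - x n)"
          by (simp add: w_def algebra_simps)
        then show "norm (norm (x (Suc n) - u) - norm (w n)) \<le> norm ((t n - 1) *\<^sub>R (x (Suc n) - x n))"
          by (metis norm_triangle_ineq3 norm_minus_commute real_norm_def)
      qed
    qed
    from tendsto_add[OF this w] show ?thesis by (auto simp: convergent_def)
  qed
  have "\<exists>l\<in>Z. (\<lambda>n. x (Suc n)) \<longlonglongrightarrow> l"
  proof (rule opial[OF Z(1) dist])
    fix r :: "nat \<Rightarrow> nat" and l
    assume r: "strict_mono r" and l: "(\<lambda>n. x (Suc (r n))) \<longlonglongrightarrow> l"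
    have "(\<lambda>n. e (r n) + \<phi>') \<longlonglongrightarrow> 0 + \<phi>'"
      using LIMSEQ_subseq_LIMSEQ[OF e_lim r] by (intro tendsto_intros) (simp add: comp_def)
    moreover have "(\<lambda>n. \<kappa> * ((t (r n))\<^sup>2 * E (r n)) + \<omega>') \<longlonglongrightarrow> \<kappa> * 0 + \<omega>'"
      using LIMSEQ_subseq_LIMSEQ[OF E_lim r] by (intro tendsto_intros) (simp add: comp_def)
    moreover have "\<omega> (x (Suc (r n))) \<le> \<kappa> * ((t (r n))\<^sup>2 * E (r n)) + \<omega>'" for n
      using q_le[of "r n"] by (simp add: q_def)
    ultimately show "l \<in> Z"
      using closed[of "\<lambda>n. x (Suc (r n))" l "\<lambda>n. \<kappa> * ((t (r n))\<^sup>2 * E (r n)) + \<omega>'", OF xD l] by (simp add: e_def)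
  qed
  then show ?thesis by (simp add: filterlim_sequentially_Suc)
qed

section \<open>Extended-valued objectives\<close>

lemma argmin_set_iff: "x \<in> argmin_set h \<longleftrightarrow> (\<forall>z. h x \<le> h z)"
  by (auto simp: argmin_set_def is_arg_min_def not_less)

lemma ereal_real_part:
  assumes "proper h" "z \<in> effective_domain h"
  shows "h z = ereal (real_of_ereal (h z))"
  using assms by (cases "h z") (auto simp: proper_def effective_domain_def)

lemma convex_on_real_part:
  assumes h: "proper h" "convex_ereal h"
  shows "convex_on (effective_domain h) (\<lambda>z. real_of_ereal (h z))"
proof -
  have le: "h (u *\<^sub>R x + v *\<^sub>R y) \<le> ereal (u * real_of_ereal (h x) + v * real_of_ereal (h y))"
    if "x \<in> effective_domain h" "y \<in> effective_domain h" "0 \<le> u" "0 \<le> v" "u + v = 1" for x y u v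
  proof -
    have "h (u *\<^sub>R x + v *\<^sub>R y) \<le> ereal u * h x + ereal v * h y"
      using h(2) that unfolding convex_ereal_def by blast
    then show ?thesis
      using ereal_real_part[OF h(1) that(1)] ereal_real_part[OF h(1) that(2)]
      by (metis plus_ereal.simps(1) times_ereal.simps(1))
  qed
  have dom: "u *\<^sub>R x + v *\<^sub>R y \<in> effective_domain h"
    if "x \<in> effective_domain h" "y \<in> effective_domain h" "0 \<le> u" "0 \<le> v" "u + v = 1" for x y u v
    using le[OF that] by (auto simp: effective_domain_def less_ereal.simps intro: le_less_trans)
  show ?thesis
    unfolding convex_on_def
  proof (intro conjI ballI allI impI)
    show "convex (effective_domain h)" using dom by (auto simp: convex_def)
    fix x y and u v :: real
    assume xy: "x \<in> effective_domain h" "y \<in> effective_domain h" "0 \<le> u" "0 \<le> v" "u + v = 1"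
    then show "real_of_ereal (h (u *\<^sub>R x + v *\<^sub>R y))
        \<le> u * real_of_ereal (h x) + v * real_of_ereal (h y)"
      using le[OF xy] ereal_real_part[OF h(1) dom[OF xy]] by (metis ereal_less_eq(3))
  qed
qed

text \<open>As \<open>\<alpha>\<close> is positive, the subproblem is finite exactly where both \<open>g\<close> and \<open>\<psi>\<close> are, so its minimiser
  lies there and the minimality can be read as a statement about real-valued functions.\<close>
lemma fbipg_iterate:
  fixes g \<psi> :: "'a::real_inner \<Rightarrow> ereal"
  assumes f: "continuously_differentiable f" and \<sigma>: "continuously_differentiable \<sigma>"
    and g: "proper g" and \<psi>: "proper \<psi>"
    and u: "u \<in> effective_domain g \<inter> effective_domain \<psi>"
    and k: "0 \<le> k" and \<alpha>: "0 < fbipg_alpha \<gamma> a k"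
    and seq: "fbipg_sequence f \<sigma> g \<psi> \<beta> \<gamma> a x"
  defines "D \<equiv> effective_domain g \<inter> effective_domain \<psi>"
    and "y \<equiv> fbipg_y a x k" and "\<alpha> \<equiv> fbipg_alpha \<gamma> a k"
  defines "G \<equiv> \<lambda>z. real_of_ereal (g z) + \<alpha> * real_of_ereal (\<psi> z)"
    and "v \<equiv> grad f y + \<alpha> *\<^sub>R grad \<sigma> y"
  shows "x (k + 1) \<in> D"
    and "w \<in> D \<Longrightarrow> G (x (k + 1)) + x (k + 1) \<bullet> v + \<beta> / 2 * (norm (x (k + 1) - y))\<^sup>2
      \<le> G w + w \<bullet> v + \<beta> / 2 * (norm (w - y))\<^sup>2"
proof -
  have "GDERIV (fbipg_smooth f \<sigma> \<gamma> a k) y :> grad f y + (\<alpha> *\<^sub>R grad \<sigma> y + \<sigma> y *\<^sub>R 0)"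
    unfolding fbipg_smooth_def \<alpha>_def
    by (intro GDERIV_add GDERIV_mult GDERIV_const GDERIV_grad f \<sigma>)
  then have v: "grad (fbipg_smooth f \<sigma> \<gamma> a k) y = v"
    by (simp add: v_def grad_eqI)
  define Q where "Q z = fbipg_nonsmooth g \<psi> \<gamma> a k z + ereal (z \<bullet> v + \<beta> / 2 * (norm (z - y))\<^sup>2)" for z
  have \<alpha>_pos: "0 < \<alpha>" using \<alpha> by (simp add: \<alpha>_def)
  have Q_D: "Q z = ereal (G z + z \<bullet> v + \<beta> / 2 * (norm (z - y))\<^sup>2)" if "z \<in> D" for z
  proof -
    have "z \<in> effective_domain g" "z \<in> effective_domain \<psi>" using that by (auto simp: D_def)
    from ereal_real_part[OF g this(1)] ereal_real_part[OF \<psi> this(2)]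
    obtain p q where "g z = ereal p" "\<psi> z = ereal q" ..
    then show ?thesis
      by (simp add: Q_def fbipg_nonsmooth_def G_def \<alpha>_def)
  qed
  have Q_out: "Q z = \<infinity>" if "z \<notin> D" for z
    using that g \<psi> \<alpha>_pos unfolding Q_def fbipg_nonsmooth_def \<alpha>_def[symmetric] D_def effective_domain_def proper_def
    by (cases "g z"; cases "\<psi> z") auto
  have "x (k + 1) \<in> argmin_set (\<lambda>z. fbipg_nonsmooth g \<psi> \<gamma> a k z
      + ereal (z \<bullet> grad (fbipg_smooth f \<sigma> \<gamma> a k) y + \<beta> / 2 * (norm (z - y))\<^sup>2))"
    using seq k unfolding fbipg_sequence_def y_def by simp
  then have "x (k + 1) \<in> argmin_set Q" unfolding v Q_def .
  then have min: "Q (x (k + 1)) \<le> Q z" for z by (simp add: argmin_set_iff)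
  show xD: "x (k + 1) \<in> D"
  proof (rule ccontr)
    assume "x (k + 1) \<notin> D"
    with min[of u] Q_out Q_D[of u] u show False by (simp add: D_def)
  qed
  show "G (x (k + 1)) + x (k + 1) \<bullet> v + \<beta> / 2 * (norm (x (k + 1) - y))\<^sup>2
      \<le> G w + w \<bullet> v + \<beta> / 2 * (norm (w - y))\<^sup>2" if "w \<in> D"
    using min[of w] Q_D[OF xD] Q_D[OF that] by simp
qed

text \<open>The limit inferior at \<open>z\<close> ignores the value at \<open>z\<close> itself, but a sequence may hit \<open>z\<close>; this is harmless,
  since the strict bound \<open>m < h z\<close> also holds there.\<close>
lemma lower_semicontinuous_le_limit:
  fixes h :: "'a::metric_space \<Rightarrow> ereal"
  assumes "lower_semicontinuous h" and xs: "xs \<longlonglongrightarrow> z"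
    and le: "\<And>n. h (xs n) \<le> ereal (c n)" and c: "c \<longlonglongrightarrow> l"
  shows "h z \<le> ereal l"
proof (rule ccontr)
  assume "\<not> h z \<le> ereal l"
  then obtain m where m: "ereal l < ereal m" "ereal m < h z"
    using ereal_dense3 by (metis ereal_dense2 not_le)
  have "ereal m < Liminf (at z) h"
    using assms(1) m(2) unfolding lower_semicontinuous_def by (meson less_le_trans)
  then have "\<forall>\<^sub>F y in at z. ereal m < h y" by (rule less_LiminfD)
  then have "\<forall>\<^sub>F y in nhds z. ereal m < h y"
    using m(2) by (simp add: eventually_at_filter) (smt (verit) eventually_mono)
  then have "\<forall>\<^sub>F n in sequentially. ereal m < h (xs n)"
    using xs unfolding filterlim_iff by blast
  moreover have "\<forall>\<^sub>F n in sequentially. c n < m"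
    using m(1) order_tendstoD(2)[OF c] by simp
  ultimately have "\<forall>\<^sub>F n in sequentially. False"
  proof eventually_elim
    case (elim n)
    with le[of n] show ?case by (meson ereal_less_eq(3) leD le_less_trans less_imp_le order_trans)
  qed
  then show False by simp
qed

lemma lsc_composite_le_limit:
  fixes s :: "'a::real_inner \<Rightarrow> real"
  assumes s: "continuously_differentiable s" and r: "proper r" "lower_semicontinuous r"
    and zs: "zs \<longlonglongrightarrow> l" and dom: "\<And>n. zs n \<in> effective_domain r"
    and le: "\<And>n. s (zs n) + real_of_ereal (r (zs n)) \<le> c n" and c: "c \<longlonglongrightarrow> C"
  shows "l \<in> effective_domain r" and "s l + real_of_ereal (r l) \<le> C"
proof -
  have "isCont s l"
    using GDERIV_grad[OF s, of l] unfolding gderiv_def by (rule has_derivative_continuous)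
  then have lim: "(\<lambda>n. c n - s (zs n)) \<longlonglongrightarrow> C - s l"
    using c zs by (intro tendsto_diff isCont_tendsto_compose[of l s])
  have "r (zs n) \<le> ereal (c n - s (zs n))" for n
    using ereal_real_part[OF r(1) dom[of n]] le[of n]
    by (metis add.commute ereal_less_eq(3) le_diff_eq)
  from lower_semicontinuous_le_limit[OF r(2) zs this lim]
  have r_le: "r l \<le> ereal (C - s l)" .
  then show l: "l \<in> effective_domain r"
    by (auto simp: effective_domain_def intro: le_less_trans)
  show "s l + real_of_ereal (r l) \<le> C"
    using r_le ereal_real_part[OF r(1) l] by (metis add.commute ereal_less_eq(3) le_diff_eq)
qed

section \<open>Convergence to a bilevel solution\<close>

theorem theorem5:
  fixes f \<sigma> :: "real ^ 'n \<Rightarrow> real"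
    and g \<psi> :: "real ^ 'n \<Rightarrow> ereal"
    and \<beta>f \<beta>\<sigma> \<tau> \<gamma> :: real
    and a :: int
    and x :: "int \<Rightarrow> real ^ 'n"
  assumes "convex_on UNIV f" and "continuously_differentiable f"
    and "\<beta>f-lipschitz_on UNIV (grad f)"
    and "convex_on UNIV \<sigma>" and "continuously_differentiable \<sigma>"
    and "\<beta>\<sigma>-lipschitz_on UNIV (grad \<sigma>)"
    and "\<beta>f + \<beta>\<sigma> > 0"
    and "proper g" and "lower_semicontinuous g" and "convex_ereal g"
    and "proper \<psi>" and "lower_semicontinuous \<psi>" and "convex_ereal \<psi>"
    and "argmin_set (composite f g) \<noteq> {}"
    and "(INF z. composite \<sigma> \<psi> z) > -\<infinity>"
    and "holder_error_bound (composite f g) \<tau>"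
    and "interior (effective_domain (composite \<sigma> \<psi>))
           \<inter> bilevel_solutions (composite f g) (composite \<sigma> \<psi>) \<noteq> {}"
    and "1 < \<gamma>" and "\<gamma> < 2" and "a > 2"
    and "fbipg_sequence f \<sigma> g \<psi> (\<beta>f + \<beta>\<sigma>) \<gamma> a x"
  shows "\<exists>x' \<in> bilevel_solutions (composite f g) (composite \<sigma> \<psi>).
           (\<lambda>k. x (int k)) \<longlonglongrightarrow> x'"
proof -
  note f = assms(1-3) and \<sigma> = assms(4-6) and \<beta> = assms(7)
    and g = assms(8-10) and \<psi> = assms(11-13) and \<gamma> = assms(18,19) and a = assms(20) and seq = assms(21)
  define Z where "Z = bilevel_solutions (composite f g) (composite \<sigma> \<psi>)"
  define X where "X = argmin_set (composite f g)"
  define Dg where "Dg = effective_domain g"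
  define D\<psi> where "D\<psi> = effective_domain \<psi>"
  define \<phi> where "\<phi> z = f z + real_of_ereal (g z)" for z
  define \<omega> where "\<omega> z = \<sigma> z + real_of_ereal (\<psi> z)" for z
  have \<phi>_eq: "composite f g z = (if z \<in> Dg then ereal (\<phi> z) else \<infinity>)" for z
    using g(1) unfolding composite_def \<phi>_def Dg_def effective_domain_def proper_def by (cases "g z") auto
  have \<omega>_eq: "composite \<sigma> \<psi> z = (if z \<in> D\<psi> then ereal (\<omega> z) else \<infinity>)" for z
    using \<psi>(1) unfolding composite_def \<omega>_def D\<psi>_def effective_domain_def proper_def by (cases "\<psi> z") auto
  have dom_\<omega>: "effective_domain (composite \<sigma> \<psi>) = D\<psi>"
    by (auto simp: effective_domain_def \<omega>_eq)
  have \<phi>_conv: "convex_on Dg \<phi>"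
    unfolding \<phi>_def Dg_def using f(1) convex_on_real_part[OF g(1,3)]
    by (intro convex_on_add convex_on_subset[OF f(1)]) (auto dest: convex_on_imp_convex)
  have \<omega>_conv: "convex_on D\<psi> \<omega>"
    unfolding \<omega>_def D\<psi>_def using \<sigma>(1) convex_on_real_part[OF \<psi>(1,3)]
    by (intro convex_on_add convex_on_subset[OF \<sigma>(1)]) (auto dest: convex_on_imp_convex)

  obtain u where u: "u \<in> interior D\<psi>" "u \<in> Z"
    using assms(17) unfolding dom_\<omega> Z_def by blast
  have uX: "u \<in> X" and uD\<psi>: "u \<in> D\<psi>"
    using u interior_subset unfolding Z_def X_def bilevel_solutions_def is_arg_min_def by auto
  have X_min: "composite f g u \<le> composite f g z" for z
    using uX by (simp add: X_def argmin_set_iff)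
  obtain z0 where "z0 \<in> Dg" using g(1) by (auto simp: proper_def Dg_def effective_domain_def)
  with X_min[of z0] have uDg: "u \<in> Dg" by (auto simp: \<phi>_eq split: if_splits)
  have \<phi>_min: "\<phi> u \<le> \<phi> z" if "z \<in> Dg" for z
    using X_min[of z] that uDg by (simp add: \<phi>_eq)
  have X_iff: "z \<in> X \<longleftrightarrow> z \<in> Dg \<and> \<phi> z \<le> \<phi> u" for z
  proof
    assume "z \<in> X"
    then have "composite f g z \<le> composite f g u" by (simp add: X_def argmin_set_iff)
    then show "z \<in> Dg \<and> \<phi> z \<le> \<phi> u" using uDg by (auto simp: \<phi>_eq split: if_splits)
  next
    assume "z \<in> Dg \<and> \<phi> z \<le> \<phi> u"
    then have "composite f g z \<le> composite f g u" using uDg by (simp add: \<phi>_eq)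
    then show "z \<in> X" using X_min by (auto simp: X_def argmin_set_iff intro: order_trans)
  qed
  have X_conv: "convex X"
  proof (rule convexI)
    fix p q and r s :: real
    assume *: "p \<in> X" "q \<in> X" "0 \<le> r" "0 \<le> s" "r + s = 1"
    have "\<phi> (r *\<^sub>R p + s *\<^sub>R q) \<le> r * \<phi> p + s * \<phi> q"
      using \<phi>_conv * by (auto simp: convex_on_def X_iff)
    also have "\<dots> \<le> r * \<phi> u + s * \<phi> u"
      using * by (intro add_mono mult_left_mono) (auto simp: X_iff)
    also have "\<dots> = \<phi> u" using *(5) by (metis distrib_right mult_1)
    finally show "r *\<^sub>R p + s *\<^sub>R q \<in> X"
      using convex_on_imp_convex[OF \<phi>_conv] * by (auto simp: X_iff intro: convexD)
  qed
  have \<omega>_min: "\<omega> u \<le> \<omega> z" if "z \<in> X" "z \<in> D\<psi>" for z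
    using u(2) that uD\<psi> unfolding Z_def bilevel_solutions_def is_arg_min_def X_def[symmetric]
    by (auto simp: \<omega>_eq not_less)
  have Z_iff: "z \<in> Z \<longleftrightarrow> z \<in> X \<and> z \<in> D\<psi> \<and> \<omega> z \<le> \<omega> u" for z
  proof
    assume "z \<in> Z"
    then have "z \<in> X" "z \<in> D\<psi>" and z: "\<not> composite \<sigma> \<psi> u < composite \<sigma> \<psi> z"
      using uX unfolding Z_def bilevel_solutions_def is_arg_min_def X_def[symmetric]
      by (auto simp: \<omega>_eq split: if_splits)
    then show "z \<in> X \<and> z \<in> D\<psi> \<and> \<omega> z \<le> \<omega> u" using uD\<psi> by (simp add: \<omega>_eq)
  next
    assume z: "z \<in> X \<and> z \<in> D\<psi> \<and> \<omega> z \<le> \<omega> u"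
    then have "\<not> composite \<sigma> \<psi> w < composite \<sigma> \<psi> z" if "w \<in> X" for w
      using \<omega>_min[OF that] by (auto simp: \<omega>_eq)
    with z show "z \<in> Z"
      unfolding Z_def bilevel_solutions_def is_arg_min_def X_def[symmetric] by (auto simp: \<omega>_eq)
  qed

  have "(INF z. composite f g z) = composite f g u"
    using X_min by (intro antisym INF_lower INF_greatest) auto
  then have inf_\<phi>: "(INF z. composite f g z) = ereal (\<phi> u)" using uDg by (simp add: \<phi>_eq)
  have growth: "\<tau> * (infdist z X)\<^sup>2 \<le> \<phi> z - \<phi> u" if "z \<in> Dg" for z
  proof -
    have "ereal (\<tau> * (infdist z X)\<^sup>2) \<le> composite f g z - (INF z. composite f g z)"
      using assms(16) unfolding holder_error_bound_def X_def by blast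
    with that show ?thesis unfolding inf_\<phi> by (simp add: \<phi>_eq)
  qed
  have \<tau>: "0 < \<tau>" using assms(16) by (simp add: holder_error_bound_def)
  obtain m where m: "m \<le> \<omega> z" if "z \<in> D\<psi>" for z
  proof -
    obtain m where "ereal m < (INF z. composite \<sigma> \<psi> z)"
      using assms(15) ereal_dense2 by blast
    then have "ereal m \<le> composite \<sigma> \<psi> z" for z
      by (meson INF_lower UNIV_I less_imp_le order_trans)
    with that show thesis by (metis \<omega>_eq ereal_less_eq(3))
  qed
  obtain r M where rM: "0 < r" "cball u r \<subseteq> D\<psi>" "\<And>v. v \<in> cball u r \<Longrightarrow> \<omega> v \<le> M"
    using convex_locally_bounded_above[OF \<omega>_conv u(1)] by blast
  define L where "L = (M - \<omega> u) / r"
  have L: "0 \<le> L" using rM(1) rM(3)[of u] by (simp add: L_def)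
  have penalty: "\<omega> u - L * infdist z X \<le> \<omega> z" if "z \<in> D\<psi>" for z
    unfolding L_def by (rule slater_exact_penalty[OF \<omega>_conv X_conv uX rM \<omega>_min that])

  define D where "D = Dg \<inter> D\<psi>"
  define A where "A = nat a"
  have A: "real A = real_of_int a" "2 < real A" "0 < A" using a by (auto simp: A_def)
  define \<alpha> where "\<alpha> n = (real n + real A) powr (- \<gamma>)" for n
  define t where "t n = (real n + real A) / real A" for n
  have \<alpha>_eq: "fbipg_alpha \<gamma> a (int n) = \<alpha> n" and t_eq: "fbipg_t a (int n) = t n" for n
    by (simp_all add: fbipg_alpha_def fbipg_t_def \<alpha>_def t_def A)
  note estimates = stepsize_estimates[OF A(2) \<gamma>, folded \<alpha>_def t_def]
  note series = stepsize_series[OF A(3) \<gamma>(1), folded \<alpha>_def t_def]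
  define xs where "xs n = x (int n)" for n
  define Y where "Y n = fbipg_y a x (int n)" for n
  have uD: "u \<in> effective_domain g \<inter> effective_domain \<psi>"
    using uDg uD\<psi> by (simp add: Dg_def D\<psi>_def)
  have \<alpha>_pos: "0 < fbipg_alpha \<gamma> a (int n)" for n
    unfolding \<alpha>_eq by (rule estimates)
  note iterate = fbipg_iterate[OF f(2) \<sigma>(2) g(1) \<psi>(1) uD of_nat_0_le_iff \<alpha>_pos seq,
      unfolded \<alpha>_eq, folded Dg_def D\<psi>_def, folded D_def]
  have xs_Suc: "x (int n + 1) = xs (Suc n)" for n by (simp add: xs_def add.commute)
  have xsD: "xs (Suc n) \<in> D" for n
    using iterate(1)[of n] by (simp add: xs_Suc)
  have D_conv: "convex D"
    unfolding D_def using \<phi>_conv \<omega>_conv by (intro convex_Int convex_on_imp_convex)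
  have g_conv: "convex_on D (\<lambda>z. real_of_ereal (g z))"
    by (rule convex_on_subset[OF convex_on_real_part[OF g(1,3)] _ D_conv]) (simp add: D_def Dg_def)
  have \<psi>_conv: "convex_on D (\<lambda>z. real_of_ereal (\<psi> z))"
    by (rule convex_on_subset[OF convex_on_real_part[OF \<psi>(1,3)] _ D_conv]) (simp add: D_def D\<psi>_def)
  have prox: "\<phi> (xs (Suc n)) + \<alpha> n * \<omega> (xs (Suc n)) + (\<beta>f + \<beta>\<sigma>) / 2 * (norm (z - xs (Suc n)))\<^sup>2
      \<le> \<phi> z + \<alpha> n * \<omega> z + (\<beta>f + \<beta>\<sigma>) / 2 * (norm (z - Y n))\<^sup>2" if z: "z \<in> D" for n z
  proof -
    define h where "h z = f z + \<alpha> n * \<sigma> z" for z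
    define v where "v = grad f (Y n) + \<alpha> n *\<^sub>R grad \<sigma> (Y n)"
    define G where "G z = real_of_ereal (g z) + \<alpha> n * real_of_ereal (\<psi> z)" for z
    have G_conv: "convex_on D G"
      unfolding G_def using g_conv \<psi>_conv estimates(1)[of n] by (intro convex_on_add convex_on_cmul) auto
    \<comment> \<open>Since \<open>\<alpha> n \<le> 1\<close>, the sum of the two Lipschitz constants serves for every regularised objective.\<close>
    have upper: "h (xs (Suc n)) \<le> h (Y n) + (xs (Suc n) - Y n) \<bullet> v
        + (\<beta>f + \<beta>\<sigma>) / 2 * (norm (xs (Suc n) - Y n))\<^sup>2"
    proof -
      have "\<alpha> n * (\<beta>\<sigma> / 2 * (norm (xs (Suc n) - Y n))\<^sup>2) \<le> 1 * (\<beta>\<sigma> / 2 * (norm (xs (Suc n) - Y n))\<^sup>2)"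
        using estimates(2)[of n] lipschitz_on_nonneg[OF \<sigma>(3)] by (intro mult_right_mono) auto
      then show ?thesis
        using descent_lemma[OF f(2,3), of "xs (Suc n)" "Y n"]
          mult_left_mono[OF descent_lemma[OF \<sigma>(2,3), of "xs (Suc n)" "Y n"] less_imp_le[OF estimates(1)[of n]]]
        by (simp add: h_def v_def inner_add_right algebra_simps add_divide_distrib)
    qed
    have lower: "h (Y n) + (z - Y n) \<bullet> v \<le> h z"
      using convex_gradient_inequality[OF f(1,2), of "Y n" z]
        mult_left_mono[OF convex_gradient_inequality[OF \<sigma>(1,2), of "Y n" z] less_imp_le[OF estimates(1)[of n]]]
      by (simp add: h_def v_def inner_add_right algebra_simps)
    have "h (xs (Suc n)) + G (xs (Suc n)) + (\<beta>f + \<beta>\<sigma>) / 2 * (norm (z - xs (Suc n)))\<^sup>2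
        \<le> h z + G z + (\<beta>f + \<beta>\<sigma>) / 2 * (norm (z - Y n))\<^sup>2"
      using iterate(2)[of _ n]
      by (intro prox_gradient_inequality[OF G_conv xsD z _ upper lower])
        (simp add: xs_Suc G_def v_def Y_def)
    then show ?thesis by (simp add: h_def G_def \<phi>_def \<omega>_def algebra_simps)
  qed
  have "\<exists>l\<in>Z. xs \<longlonglongrightarrow> l"
  proof (rule regularized_fista_converges[where D = D and \<phi> = \<phi> and \<omega> = \<omega> and d = "\<lambda>n. infdist (xs (Suc n)) X"
        and \<phi>' = "\<phi> u" and \<omega>' = "\<omega> u" and c = "1 - 2 / real A" and \<kappa> = "(real A)\<^sup>2",
        OF _ _ \<beta> xsD prox _ \<tau> _ L _ estimates(1,3,4,5,6,7,8,9) series])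
    show "convex_on D \<phi>"
      by (rule convex_on_subset[OF \<phi>_conv _ D_conv]) (simp add: D_def)
    show "convex_on D \<omega>"
      by (rule convex_on_subset[OF \<omega>_conv _ D_conv]) (simp add: D_def)
    show "Y (Suc n) = xs (Suc n) + (inverse (t (Suc n)) * (t n - 1)) *\<^sub>R (xs (Suc n) - xs n)" for n
      using t_eq[of n] t_eq[of "Suc n"] by (simp add: Y_def fbipg_y_def xs_def)
    show "0 < 1 - 2 / real A" using A by simp
    show "0 \<le> infdist (xs (Suc n)) X" for n by (rule infdist_nonneg)
    show "\<tau> * (infdist (xs (Suc n)) X)\<^sup>2 \<le> \<phi> (xs (Suc n)) - \<phi> u" for n
      using xsD[of n] growth by (simp add: D_def)
    show "\<omega> u - L * infdist (xs (Suc n)) X \<le> \<omega> (xs (Suc n))" for n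
      using xsD[of n] penalty by (simp add: D_def)
    show "m \<le> \<omega> z" if "z \<in> D" for z using that m by (simp add: D_def)
    show "Z \<noteq> {}" using u by blast
    show "v \<in> D \<and> \<phi> v = \<phi> u \<and> \<omega> v = \<omega> u" if "v \<in> Z" for v
      using that \<phi>_min[of v] \<omega>_min[of v] by (auto simp: Z_iff X_iff D_def)
    show "l \<in> Z" if zD: "\<And>n. z n \<in> D" and z: "z \<longlonglongrightarrow> l" and \<phi>_lim: "(\<lambda>n. \<phi> (z n)) \<longlonglongrightarrow> \<phi> u"
      and \<omega>_le: "\<And>n. \<omega> (z n) \<le> b n" and b: "b \<longlonglongrightarrow> \<omega> u" for z l b
    proof -
      have zdom: "z n \<in> effective_domain g" "z n \<in> effective_domain \<psi>" for n
        using zD[of n] by (auto simp: D_def Dg_def D\<psi>_def)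
      have "l \<in> Dg" "\<phi> l \<le> \<phi> u"
        using lsc_composite_le_limit[OF f(2) g(1,2) z zdom(1) _ \<phi>_lim]
        by (auto simp: \<phi>_def Dg_def)
      moreover have "l \<in> D\<psi>" "\<omega> l \<le> \<omega> u"
        using lsc_composite_le_limit[OF \<sigma>(2) \<psi>(1,2) z zdom(2) _ b] \<omega>_le
        by (auto simp: \<omega>_def D\<psi>_def)
      ultimately show ?thesis by (simp add: Z_iff X_iff)
    qed
  qed
  moreover have "xs = (\<lambda>k. x (int k))" by (simp add: xs_def fun_eq_iff)
  ultimately show ?thesis unfolding Z_def by metis
qed

end
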